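(* A 1-courteous coloring with minimum number of colors of a bridgeless matroid can be found in polynomial time, given an independence oracle for the matroid. In particular, an edge-1-color-avoiding connected coloring with minimum number of colors of a 2-edge-connected graph $G$ can be found in polynomial time.
   Context: A cut of a matroid is a circuit of its dual matroid; a bridge is a cut of size 1; bridgeless means no bridge. A coloring of a matroid assigns a color to each element of the ground set; it is 1-courteous if deleting all elements of any single color does not decrease the rank. An independence oracle answers, for any subset of the ground set, whether it is independent; running time counts oracle calls and elementary steps. For a graph $G$ (possibly with loops and parallel edges), an edge-coloring $f\colon E(G)\to C$ ($C$ finite) is edge-1-color-avoiding connected if for every color $c\in C$, the graph obtained by deleting all edges of color $c$ is connected. A graph is 2-edge-connected if it has at least two vertices and there are at least two edge-disjoint paths between any two vertices, or it is a one-vertex graph with at least two loops. *)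

theory Defs
  imports Main "HOL-Library.Uprod" "HOL-Computational_Algebra.Polynomial"
begin

section \<open>Matroids\<close>

record 'a set_system =
  ground :: "'a set"
  indep :: "'a set set"

locale matroid =
  fixes M :: "'a set_system"
  assumes finite_ground: "finite (ground M)"
    and indep_subset: "X \<in> indep M \<Longrightarrow> X \<subseteq> ground M"
    and indep_empty: "{} \<in> indep M"
    and indep_hereditary: "Y \<in> indep M \<Longrightarrow> X \<subseteq> Y \<Longrightarrow> X \<in> indep M"
    and indep_augment: "X \<in> indep M \<Longrightarrow> Y \<in> indep M \<Longrightarrow> card X < card Y \<Longrightarrow>
      \<exists>y\<in>Y - X. insert y X \<in> indep M"

definition basis :: "'a set_system \<Rightarrow> 'a set \<Rightarrow> bool" where
  "basis M B \<longleftrightarrow> B \<in> indep M \<and> (\<forall>X\<in>indep M. B \<subseteq> X \<longrightarrow> X = B)"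

definition rank :: "'a set_system \<Rightarrow> nat" where
  "rank M = Max (card ` indep M)"

definition circuit :: "'a set_system \<Rightarrow> 'a set \<Rightarrow> bool" where
  "circuit M C \<longleftrightarrow> C \<subseteq> ground M \<and> C \<notin> indep M \<and> (\<forall>D. D \<subset> C \<longrightarrow> D \<in> indep M)"

definition dual :: "'a set_system \<Rightarrow> 'a set_system" where
  "dual M = \<lparr>ground = ground M, indep = {X. \<exists>B. basis M B \<and> X \<subseteq> ground M - B}\<rparr>"

definition delete :: "'a set_system \<Rightarrow> 'a set \<Rightarrow> 'a set_system" where
  "delete M X = \<lparr>ground = ground M - X, indep = {I \<in> indep M. I \<subseteq> ground M - X}\<rparr>"

definition cut :: "'a set_system \<Rightarrow> 'a set \<Rightarrow> bool" where
  "cut M X \<longleftrightarrow> circuit (dual M) X"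

definition bridge :: "'a set_system \<Rightarrow> 'a set \<Rightarrow> bool" where
  "bridge M X \<longleftrightarrow> cut M X \<and> card X = 1"

definition bridgeless :: "'a set_system \<Rightarrow> bool" where
  "bridgeless M \<longleftrightarrow> (\<nexists>X. bridge M X)"

definition courteous1 :: "'a set_system \<Rightarrow> ('a \<Rightarrow> 'c) \<Rightarrow> bool" where
  "courteous1 M f \<longleftrightarrow> (\<forall>c. rank (delete M {e \<in> ground M. f e = c}) = rank M)"

definition min_courteous1 :: "'a set_system \<Rightarrow> ('a \<Rightarrow> nat) \<Rightarrow> bool" where
  "min_courteous1 M f \<longleftrightarrow> courteous1 M f \<and>
    (\<forall>g :: 'a \<Rightarrow> nat. courteous1 M g \<longrightarrow> card (f ` ground M) \<le> card (g ` ground M))"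


section \<open>Multigraphs\<close>

text \<open>Undirected graphs with parallel edges and loops; a loop at \<open>v\<close> has ends \<open>Upair v v\<close>.\<close>

record ('v, 'e) multigraph =
  verts :: "'v set"
  edges :: "'e set"
  ends :: "'e \<Rightarrow> 'v uprod"

definition finite_multigraph :: "('v, 'e) multigraph \<Rightarrow> bool" where
  "finite_multigraph G \<longleftrightarrow> finite (verts G) \<and> finite (edges G) \<and>
    (\<forall>e\<in>edges G. set_uprod (ends G e) \<subseteq> verts G)"

text \<open>A walk from \<open>u\<close> is the list of its steps, each an edge together with the vertex it leads to.\<close>

fun walk :: "('v, 'e) multigraph \<Rightarrow> 'v \<Rightarrow> ('e \<times> 'v) list \<Rightarrow> 'v \<Rightarrow> bool" where
  "walk G u [] v \<longleftrightarrow> u = v \<and> u \<in> verts G"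
| "walk G u ((e, w) # p) v \<longleftrightarrow>
     u \<in> verts G \<and> e \<in> edges G \<and> ends G e = Upair u w \<and> walk G w p v"

definition path :: "('v, 'e) multigraph \<Rightarrow> 'v \<Rightarrow> ('e \<times> 'v) list \<Rightarrow> 'v \<Rightarrow> bool" where
  "path G u p v \<longleftrightarrow> walk G u p v \<and> distinct (u # map snd p)"

definition path_edges :: "('e \<times> 'v) list \<Rightarrow> 'e set" where
  "path_edges p = fst ` set p"

definition connected_graph :: "('v, 'e) multigraph \<Rightarrow> bool" where
  "connected_graph G \<longleftrightarrow> verts G \<noteq> {} \<and> (\<forall>u\<in>verts G. \<forall>v\<in>verts G. \<exists>p. path G u p v)"

definition two_edge_connected :: "('v, 'e) multigraph \<Rightarrow> bool" where
  "two_edge_connected G \<longleftrightarrow>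
    card (verts G) \<ge> 2 \<and>
      (\<forall>u\<in>verts G. \<forall>v\<in>verts G. u \<noteq> v \<longrightarrow>
        (\<exists>p q. path G u p v \<and> path G u q v \<and> path_edges p \<inter> path_edges q = {})) \<or>
    card (verts G) = 1 \<and>
      card {e \<in> edges G. \<exists>v. ends G e = Upair v v} \<ge> 2"

definition delete_edges :: "('v, 'e) multigraph \<Rightarrow> 'e set \<Rightarrow> ('v, 'e) multigraph" where
  "delete_edges G F = G\<lparr>edges := edges G - F\<rparr>"

definition edge1_color_avoiding_connected ::
  "('v, 'e) multigraph \<Rightarrow> 'c set \<Rightarrow> ('e \<Rightarrow> 'c) \<Rightarrow> bool" where
  "edge1_color_avoiding_connected G C f \<longleftrightarrow> finite C \<and> f ` edges G \<subseteq> C \<and>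
    (\<forall>c\<in>C. connected_graph (delete_edges G {e \<in> edges G. f e = c}))"

definition min_edge1_color_avoiding_connected ::
  "('v, 'e) multigraph \<Rightarrow> ('e \<Rightarrow> nat) \<Rightarrow> bool" where
  "min_edge1_color_avoiding_connected G f \<longleftrightarrow>
    edge1_color_avoiding_connected G (f ` edges G) f \<and>
    (\<forall>(C :: nat set) g. edge1_color_avoiding_connected G C g \<longrightarrow>
      card (f ` edges G) \<le> card (g ` edges G))"


section \<open>Oracle programs and their running time\<close>

text \<open>
  A while language over finitely many named arrays of natural numbers, in effect a random access
  machine. Scalars are kept in cell 0 of an array. Every node of an evaluated expression costs one
  step. The only arithmetic is addition and truncated subtraction, so the bit length of any
  stored number grows at most linearly with the number of steps, and unit costs are polynomially
  equivalent to Turing machine time.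
\<close>

datatype aexp = Const nat | Cell string aexp | Plus aexp aexp | Minus aexp aexp

datatype bexp = Less aexp aexp | Equal aexp aexp | Not bexp | And bexp bexp

datatype com =
    Skip
  | Assign string aexp aexp  \<comment> \<open>\<open>Assign x i e\<close> stores \<open>e\<close> in cell \<open>i\<close> of \<open>x\<close>\<close>
  | Seq com com
  | If bexp com com
  | While bexp com
  | Query string string  \<comment> \<open>\<open>Query x y\<close> asks about the set with characteristic vector \<open>y\<close>\<close>

type_synonym store = "string \<Rightarrow> nat \<Rightarrow> nat"

type_synonym oracle_fun = "nat set \<Rightarrow> bool"

fun aval :: "aexp \<Rightarrow> store \<Rightarrow> nat" where
  "aval (Const k) s = k"
| "aval (Cell x i) s = s x (aval i s)"
| "aval (Plus a b) s = aval a s + aval b s"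
| "aval (Minus a b) s = aval a s - aval b s"

fun bval :: "bexp \<Rightarrow> store \<Rightarrow> bool" where
  "bval (Less a b) s \<longleftrightarrow> aval a s < aval b s"
| "bval (Equal a b) s \<longleftrightarrow> aval a s = aval b s"
| "bval (Not b) s \<longleftrightarrow> \<not> bval b s"
| "bval (And b c) s \<longleftrightarrow> bval b s \<and> bval c s"

fun acost :: "aexp \<Rightarrow> nat" where
  "acost (Const k) = 1"
| "acost (Cell x i) = 1 + acost i"
| "acost (Plus a b) = 1 + acost a + acost b"
| "acost (Minus a b) = 1 + acost a + acost b"

fun bcost :: "bexp \<Rightarrow> nat" where
  "bcost (Less a b) = 1 + acost a + acost b"
| "bcost (Equal a b) = 1 + acost a + acost b"
| "bcost (Not b) = 1 + bcost b"
| "bcost (And b c) = 1 + bcost b + bcost c"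

text \<open>
  \<open>exec orc c s t s'\<close>: with oracle \<open>orc\<close>, program \<open>c\<close> started in store \<open>s\<close> halts in store \<open>s'\<close>
  after exactly \<open>t\<close> steps. An oracle call costs one step; building its argument is paid for by
  the assignments to the array.
\<close>

inductive exec :: "oracle_fun \<Rightarrow> com \<Rightarrow> store \<Rightarrow> nat \<Rightarrow> store \<Rightarrow> bool"
  for orc :: oracle_fun where
  Skip: "exec orc Skip s 1 s"
| Assign: "exec orc (Assign x i e) s (1 + acost i + acost e)
    (s(x := (s x)(aval i s := aval e s)))"
| Seq: "exec orc c s t s' \<Longrightarrow> exec orc d s' t' s'' \<Longrightarrow> exec orc (Seq c d) s (t + t') s''"
| IfTrue: "bval b s \<Longrightarrow> exec orc c s t s' \<Longrightarrow> exec orc (If b c d) s (1 + bcost b + t) s'"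
| IfFalse: "\<not> bval b s \<Longrightarrow> exec orc d s t s' \<Longrightarrow> exec orc (If b c d) s (1 + bcost b + t) s'"
| WhileFalse: "\<not> bval b s \<Longrightarrow> exec orc (While b c) s (1 + bcost b) s"
| WhileTrue: "bval b s \<Longrightarrow> exec orc c s t s' \<Longrightarrow> exec orc (While b c) s' t' s'' \<Longrightarrow>
    exec orc (While b c) s (1 + bcost b + t + t') s''"
| Query: "exec orc (Query x y) s 1
    (s(x := (s x)(0 := (if orc {i. s y i \<noteq> 0} then 1 else 0))))"

inductive_cases exec_SkipE: "exec orc Skip s t s'"
inductive_cases exec_AssignE: "exec orc (Assign x i e) s t s'"
inductive_cases exec_SeqE: "exec orc (Seq c d) s t s'"
inductive_cases exec_IfE: "exec orc (If b c d) s t s'"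
inductive_cases exec_WhileE: "exec orc (While b c) s t s'"
inductive_cases exec_QueryE: "exec orc (Query x y) s t s'"

lemma exec_deterministic:
  "exec orc c s t s' \<Longrightarrow> exec orc c s r s'' \<Longrightarrow> t = r \<and> s' = s''"
proof (induction arbitrary: r s'' rule: exec.induct)
  case (Seq c s t s' d t' s2)
  from Seq.prems obtain t1 s1 t2 where 1: "exec orc c s t1 s1" "exec orc d s1 t2 s''"
    and r: "r = t1 + t2" by (rule exec_SeqE)
  from Seq.IH(1)[OF 1(1)] have "t = t1" "s' = s1" by simp_all
  with Seq.IH(2)[of t2 s''] 1(2) r show ?case by simp
next
  case (IfTrue b s c t s' d)
  from IfTrue.prems obtain t1 where 1: "exec orc c s t1 s''"
    and r: "r = 1 + bcost b + t1" by (rule exec_IfE) (simp_all add: IfTrue.hyps)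
  from IfTrue.IH[OF 1] r show ?case by simp
next
  case (IfFalse b s d t s' c)
  from IfFalse.prems obtain t1 where 1: "exec orc d s t1 s''"
    and r: "r = 1 + bcost b + t1" by (rule exec_IfE) (simp_all add: IfFalse.hyps)
  from IfFalse.IH[OF 1] r show ?case by simp
next
  case (WhileFalse b s c)
  from WhileFalse.prems show ?case
    by (rule exec_WhileE) (simp_all add: WhileFalse.hyps)
next
  case (WhileTrue b s c t s' t' s2)
  from WhileTrue.prems obtain t1 s1 t2 where
    1: "exec orc c s t1 s1" "exec orc (While b c) s1 t2 s''" and r: "r = 1 + bcost b + t1 + t2"
    by (rule exec_WhileE) (simp_all add: WhileTrue.hyps)
  from WhileTrue.IH(1)[OF 1(1)] have "t = t1" "s' = s1" by simp_all
  with WhileTrue.IH(2)[of t2 s''] 1(2) r show ?case by simp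
next
  case Skip then show ?case by (rule exec_SkipE) simp
next
  case Assign then show ?case by (rule exec_AssignE) simp
next
  case Query then show ?case by (rule exec_QueryE) simp
qed

fun oracle_free :: "com \<Rightarrow> bool" where
  "oracle_free Skip \<longleftrightarrow> True"
| "oracle_free (Assign x i e) \<longleftrightarrow> True"
| "oracle_free (Seq c d) \<longleftrightarrow> oracle_free c \<and> oracle_free d"
| "oracle_free (If b c d) \<longleftrightarrow> oracle_free c \<and> oracle_free d"
| "oracle_free (While b c) \<longleftrightarrow> oracle_free c"
| "oracle_free (Query x y) \<longleftrightarrow> False"

text \<open>All cells not mentioned in the input are 0.\<close>

definition input_store :: "(string \<times> nat list) list \<Rightarrow> store" where
  "input_store xs = (\<lambda>x i. case map_of xs x of
     None \<Rightarrow> 0 | Some l \<Rightarrow> if i < length l then l ! i else 0)"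

definition enumerates :: "'a list \<Rightarrow> 'a set \<Rightarrow> bool" where
  "enumerates xs A \<longleftrightarrow> distinct xs \<and> set xs = A"

text \<open>
  Programs address an element of a finite set by its position in an enumeration of the set.
  Positions beyond the end of the enumeration are ignored by the oracle.
\<close>

definition indep_oracle :: "'a set_system \<Rightarrow> 'a list \<Rightarrow> oracle_fun" where
  "indep_oracle M es S \<longleftrightarrow> {es ! i | i. i < length es \<and> i \<in> S} \<in> indep M"

definition matroid_input :: "'a list \<Rightarrow> store" where
  "matroid_input es = input_store [(''n'', [length es])]"

text \<open>
  The input for a graph consists of the numbers of vertices and edges and, for the \<open>j\<close>-th edge, the
  positions \<open>us ! j\<close> and \<open>ws ! j\<close> of its two ends, in either order.
\<close>

definition graph_input ::
  "('v, 'e) multigraph \<Rightarrow> 'v list \<Rightarrow> 'e list \<Rightarrow> store \<Rightarrow> bool" where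
  "graph_input G vs es s \<longleftrightarrow> enumerates vs (verts G) \<and> enumerates es (edges G) \<and>
    (\<exists>us ws. length us = length es \<and> length ws = length es \<and>
      (\<forall>j<length es. us ! j < length vs \<and> ws ! j < length vs \<and>
        ends G (es ! j) = Upair (vs ! (us ! j)) (vs ! (ws ! j))) \<and>
      s = input_store [(''n'', [length vs]), (''m'', [length es]), (''u'', us), (''w'', ws)])"

definition output_coloring :: "'a list \<Rightarrow> store \<Rightarrow> ('a \<Rightarrow> nat) \<Rightarrow> bool" where
  "output_coloring es s f \<longleftrightarrow> (\<forall>i<length es. f (es ! i) = s ''f'' i)"

end

(*
A coloring is 1-courteous iff every color class is independent in the dual matroid, so a minimum
1-courteous coloring is a partition of the ground set into the fewest dual-independent sets, and
bridgelessness says that the dual has no loops. Such a partition is found by Edmonds' augmenting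
path method: elements are inserted one at a time, and an uncolored element x is moved along a
shortest path of exchanges until some class can absorb an element without giving one up. Only one
exchange is made before the distances are recomputed: the distance of the element that becomes
uncolored is strictly smaller than that of x. If there is no path from x, the unreachable colored
elements together with x form a set A with |A| > k r(A), where k is the number of colors in use,
so k colors do not suffice and a new color is opened.
For graphs the same algorithm is run on the cographic matroid, whose independent sets are the edge
sets with connected complement; the independence test is then a connectivity test.
*)

theory Submission
  imports Defs
begin

section \<open>Matroids\<close>

text \<open>Recoloring along a whole shortest path at once would force all exchanges to be verified
  simultaneously. A single exchange avoids this: it alters one class only, where \<open>x\<close>
  enters and \<open>y\<close> leaves. An arc into that class that starts at a position closer to a
  dummy survives, because \<open>x\<close> has no arc that skips a level; this is what
  \<open>indep_exchange\<close> is for. The strict decrease of the level of the uncolored element is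
  then the termination measure. Running time is handled without counting steps.
  \<open>cost_bound N\<close> depends on the program text alone, is a polynomial in
  \<open>N\<close>, and is valid as soon as no loop makes more than \<open>N\<close> rounds each
  time it is entered. Every loop therefore only has to supply a measure that starts at or below
  \<open>N\<close>. Optimality needs no argument at the end: \<open>lower_bound k\<close> is an
  invariant of the whole run, certified anew each time a color is opened.\<close>

lemma card_swap: "finite A \<Longrightarrow> y \<in> A \<Longrightarrow> e \<notin> A \<Longrightarrow> card (insert e (A - {y})) = card A"
  by (metis DiffD1 card.remove card_insert_disjoint finite_Diff)

context matroid
begin

lemma finite_indep: "X \<in> indep M \<Longrightarrow> finite X"
  using indep_subset finite_ground finite_subset by blast

text \<open>Augmentation repeated until the size of \<open>B\<close> is reached. Both exchange
  lemmas and the dual axioms rest on it, so that circuits never have to be handled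
  explicitly.\<close>

lemma indep_extend:
  assumes "A \<in> indep M" "B \<in> indep M" "card A \<le> card B"
  obtains K where "A \<subseteq> K" "K \<subseteq> A \<union> B" "K \<in> indep M" "card K = card B"
proof -
  have "\<exists>K. A \<subseteq> K \<and> K \<subseteq> A \<union> B \<and> K \<in> indep M \<and> card K = card B"
    using assms
  proof (induction "card B - card A" arbitrary: A)
    case 0
    then show ?case by (intro exI[of _ A]) auto
  next
    case (Suc d)
    have "card A < card B" using Suc.hyps(2) by linarith
    then obtain y where y: "y \<in> B - A" "insert y A \<in> indep M"
      using indep_augment[OF Suc.prems(1,2)] by blast
    have "card (insert y A) = Suc (card A)"
      using y finite_indep[OF Suc.prems(1)] by simp
    then have "d = card B - card (insert y A)" "card (insert y A) \<le> card B"
      using Suc.hyps(2) by linarith+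
    from Suc.hyps(1)[OF this(1) y(2) Suc.prems(2) this(2)]
    obtain K where "insert y A \<subseteq> K" "K \<subseteq> insert y A \<union> B" "K \<in> indep M" "card K = card B"
      by blast
    then show ?case using y by (intro exI[of _ K]) auto
  qed
  then show thesis using that by blast
qed

text \<open>The circuit in \<open>insert e I\<close> passes through \<open>y\<close>, and it is also
  the only circuit in \<open>insert e J\<close>, so removing \<open>y\<close> destroys it there as
  well. Thus an exchange that is valid in a set stays valid after the set has grown.\<close>

lemma indep_exchange:
  assumes "J \<in> indep M" "I \<subseteq> J" "y \<in> I" "insert e I \<notin> indep M" "insert e (I - {y}) \<in> indep M"
  shows "insert e (J - {y}) \<in> indep M"
proof -
  have fin: "finite J" using assms(1) finite_indep by blast
  have eJ: "e \<notin> J" using assms(1,2,4) indep_hereditary[of J "insert e I"] by blast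
  have "card (insert e (I - {y})) = card I"
    using eJ assms(2,3) fin by (intro card_swap) (auto intro: finite_subset)
  then have "card (insert e (I - {y})) \<le> card J" using assms(2) fin by (simp add: card_mono)
  then obtain K where K: "insert e (I - {y}) \<subseteq> K" "K \<subseteq> insert e (I - {y}) \<union> J" "K \<in> indep M"
    "card K = card J"
    using indep_extend[OF assms(5,1)] by blast
  have "y \<notin> K"
  proof
    assume "y \<in> K"
    then have "insert e I \<subseteq> K" using K(1) by auto
    then show False using K(3) assms(4) indep_hereditary by blast
  qed
  then have "K \<subseteq> insert e (J - {y})" using K(2) assms(2) by auto
  moreover have "card (insert e (J - {y})) = card J"
    using eJ assms(2,3) fin by (intro card_swap) auto
  ultimately have "K = insert e (J - {y})" using K(4) fin by (intro card_subset_eq) auto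
  then show ?thesis using K(3) by simp
qed

text \<open>The circuit in \<open>insert z I\<close> survives the removal of any element of
  \<open>I - J\<close>, hence lies in \<open>insert z J\<close>. The proof counts instead: an
  independent \<open>insert z J\<close>, grown inside \<open>insert z I\<close> to the size of
  \<open>I\<close>, would leave out exactly one element of \<open>I\<close>, which is a forbidden
  exchange.\<close>

lemma dep_of_no_exchange:
  assumes "I \<in> indep M" "J \<subseteq> I" "insert z I \<notin> indep M"
    and "\<And>y. y \<in> I - J \<Longrightarrow> insert z (I - {y}) \<notin> indep M"
  shows "insert z J \<notin> indep M"
proof
  assume zJ: "insert z J \<in> indep M"
  have fin: "finite I" using assms(1) finite_indep by blast
  have zI: "z \<notin> I" using assms(1,3) by (metis insert_absorb)
  have "J \<subset> I" using zJ assms(2,3) by auto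
  then have "card J < card I" "finite J"
    using fin by (auto intro: psubset_card_mono finite_subset)
  then have "card (insert z J) \<le> card I" by (simp add: card_insert_if)
  then obtain K where K: "insert z J \<subseteq> K" "K \<subseteq> insert z J \<union> I" "K \<in> indep M" "card K = card I"
    using indep_extend[OF zJ assms(1)] by blast
  have "insert z I \<noteq> K" using K assms(3) by auto
  then obtain y where y: "y \<in> I - K" using K(1,2) assms(2) by blast
  have "K \<subseteq> insert z (I - {y})" using K y assms(2) by auto
  moreover have "card (insert z (I - {y})) = card I"
    using zI y fin by (intro card_swap) auto
  ultimately have "K = insert z (I - {y})" using K(4) fin by (intro card_subset_eq) auto
  moreover have "y \<in> I - J" using y K(1) by auto
  ultimately show False using assms(4) K(3) by auto
qed

section \<open>Bases, rank and the dual matroid\<close>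

lemma basis_card_maximal:
  assumes "basis M B" "X \<in> indep M"
  shows "card X \<le> card B"
proof (rule ccontr)
  assume "\<not> card X \<le> card B"
  then obtain y where "y \<in> X - B" "insert y B \<in> indep M"
    using indep_augment[of B X] assms unfolding basis_def by auto
  then show False using assms(1) unfolding basis_def by blast
qed

lemma basis_of_card:
  assumes "basis M B" "X \<in> indep M" "card X = card B"
  shows "basis M X"
  unfolding basis_def
proof (intro conjI ballI impI)
  fix Y assume "Y \<in> indep M" "X \<subseteq> Y"
  then show "Y = X"
    using basis_card_maximal[OF assms(1), of Y] assms(3) finite_indep[of Y] card_seteq[of Y X]
    by simp
qed (fact assms(2))

lemma finite_indep_sets: "finite (indep M)"
  by (rule finite_subset[of _ "Pow (ground M)"]) (use indep_subset finite_ground in auto)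

lemma basis_exists: obtains B where "basis M B"
proof -
  obtain B where "B \<in> indep M" "\<And>X. X \<in> indep M \<Longrightarrow> B \<subseteq> X \<Longrightarrow> X = B"
    using finite_has_maximal[OF finite_indep_sets] indep_empty by blast
  then show thesis using that unfolding basis_def by blast
qed

lemma rank_basis: "basis M B \<Longrightarrow> rank M = card B"
  unfolding rank_def using basis_card_maximal finite_indep_sets
  by (intro Max_eqI) (auto simp: basis_def)

text \<open>For augmentation, \<open>B2 - X\<close> is completed from \<open>B1\<close> to a basis
  \<open>B\<close>. Both sources avoid \<open>X\<close>, so \<open>B\<close> does too, and any
  element of \<open>Y - X\<close> missed by \<open>B\<close> can be added to
  \<open>X\<close>.\<close>

lemma matroid_dual: "matroid (dual M)"
proof
  show "finite (ground (dual M))" by (simp add: dual_def finite_ground)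
  show "X \<subseteq> ground (dual M)" if "X \<in> indep (dual M)" for X using that by (auto simp: dual_def)
  show "{} \<in> indep (dual M)" using basis_exists by (auto simp: dual_def)
  show "X \<in> indep (dual M)" if "Y \<in> indep (dual M)" "X \<subseteq> Y" for X Y
    using that by (auto simp: dual_def)
next
  fix X Y assume X: "X \<in> indep (dual M)" and Y: "Y \<in> indep (dual M)" and less: "card X < card Y"
  obtain B1 where B1: "basis M B1" "X \<subseteq> ground M - B1" using X by (auto simp: dual_def)
  obtain B2 where B2: "basis M B2" "Y \<subseteq> ground M - B2" using Y by (auto simp: dual_def)
  have fin: "finite X" "finite Y" using B1 B2 finite_ground finite_subset by blast+
  have i: "B1 \<in> indep M" "B2 \<in> indep M" using B1 B2 by (auto simp: basis_def)
  have i2: "B2 - X \<in> indep M" using i(2) indep_hereditary by blast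
  obtain B where B: "B2 - X \<subseteq> B" "B \<subseteq> (B2 - X) \<union> B1" "B \<in> indep M" "card B = card B1"
    using indep_extend[OF i2 i(1)] basis_card_maximal[OF B1(1) i2] by blast
  have basis: "basis M B" using basis_of_card[OF B1(1) B(3,4)] .
  \<comment> \<open>Otherwise \<open>B\<close> contains \<open>B2 - X\<close> and the disjoint set
    \<open>Y - X\<close>. Compared with \<open>B2\<close> it lacks at most
    \<open>B2 \<inter> X\<close>, which lies in \<open>X - Y\<close> and is smaller than
    \<open>Y - X\<close>, so \<open>B\<close> would be larger than a basis.\<close>
  have "\<not> Y - X \<subseteq> B"
  proof
    assume "Y - X \<subseteq> B"
    then have "(B2 - X) \<union> (Y - X) \<subseteq> B" using B(1) by blast
    then have "card ((B2 - X) \<union> (Y - X)) \<le> card B2"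
      using basis_card_maximal[OF B2(1) B(3)] finite_indep[OF B(3)] by (meson card_mono le_trans)
    moreover have "card ((B2 - X) \<union> (Y - X)) = card (B2 - X) + card (Y - X)"
      using B2(2) fin finite_indep[OF i(2)] by (intro card_Un_disjoint) auto
    moreover have "card B2 = card (B2 - X) + card (B2 \<inter> X)"
      using finite_indep[OF i(2)] by (simp add: card_Diff_subset_Int card_mono)
    moreover have "card (B2 \<inter> X) \<le> card (X - Y)" using fin B2(2) by (intro card_mono) auto
    moreover have "card (X - Y) < card (Y - X)"
      using less fin by (simp add: card_less_sym_Diff)
    ultimately show False by linarith
  qed
  then obtain y where y: "y \<in> Y - X" "y \<notin> B" by blast
  have "insert y X \<subseteq> ground M - B" using y B(2) B1(2) B2(2) by auto
  then show "\<exists>y\<in>Y - X. insert y X \<in> indep (dual M)" using y basis by (auto simp: dual_def)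
qed

text \<open>The rank survives exactly when some basis avoids \<open>X\<close>. This turns
  \<open>courteous1\<close> into independence of the color classes in the dual.\<close>

lemma rank_delete_eq_iff:
  assumes "X \<subseteq> ground M"
  shows "rank (delete M X) = rank M \<longleftrightarrow> X \<in> indep (dual M)"
proof
  assume r: "rank (delete M X) = rank M"
  have "finite (indep (delete M X))" "{} \<in> indep (delete M X)"
    using finite_indep_sets indep_empty by (auto simp: delete_def)
  then have "rank (delete M X) \<in> card ` indep (delete M X)"
    unfolding rank_def by (intro Max_in) auto
  then obtain I where I: "I \<in> indep M" "I \<subseteq> ground M - X" "card I = rank M"
    using r by (auto simp: delete_def)
  obtain B where "basis M B" using basis_exists .
  then have "basis M I" using I basis_of_card rank_basis by metis
  then show "X \<in> indep (dual M)" using I assms by (auto simp: dual_def)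
next
  assume "X \<in> indep (dual M)"
  then obtain B where B: "basis M B" "X \<subseteq> ground M - B" by (auto simp: dual_def)
  have "B \<in> indep M" using B by (simp add: basis_def)
  then have "B \<in> indep (delete M X)" using B indep_subset by (auto simp: delete_def)
  then show "rank (delete M X) = rank M"
    unfolding rank_basis[OF B(1)] unfolding rank_def
    using finite_indep_sets basis_card_maximal[OF B(1)] by (intro Max_eqI) (auto simp: delete_def)
qed

lemma indep_dual_singleton:
  assumes "bridgeless M" "e \<in> ground M"
  shows "{e} \<in> indep (dual M)"
proof (rule ccontr)
  assume "{e} \<notin> indep (dual M)"
  moreover have "D \<in> indep (dual M)" if "D \<subset> {e}" for D
    using that matroid.indep_empty[OF matroid_dual] by (cases "D = {}") auto
  ultimately have "bridge M {e}" using assms(2) by (auto simp: bridge_def cut_def circuit_def dual_def)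
  then show False using assms(1) by (auto simp: bridgeless_def)
qed

end

text \<open>Programs see elements only as positions, so the matroid is pulled back along
  \<open>es\<close>; for an enumeration of the ground set this is an isomorphic copy.\<close>

definition index_matroid :: "'a set_system \<Rightarrow> 'a list \<Rightarrow> nat set_system" where
  "index_matroid M es = \<lparr>ground = {..<length es},
     indep = {X. X \<subseteq> {..<length es} \<and> (!) es ` X \<in> indep M}\<rparr>"

lemma matroid_index_matroid:
  assumes "matroid M" "distinct es"
  shows "matroid (index_matroid M es)"
proof -
  interpret matroid M by fact
  have inj: "inj_on ((!) es) X" if "X \<subseteq> {..<length es}" for X
    using assms(2) that by (intro inj_on_nth) auto
  show ?thesis
  proof
    fix X Y assume X: "X \<in> indep (index_matroid M es)" and Y: "Y \<in> indep (index_matroid M es)"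
      and less: "card X < card Y"
    have "card ((!) es ` X) < card ((!) es ` Y)"
      using X Y less inj by (auto simp: index_matroid_def card_image)
    then obtain v where "v \<in> (!) es ` Y - (!) es ` X" "insert v ((!) es ` X) \<in> indep M"
      using indep_augment[of "(!) es ` X" "(!) es ` Y"] X Y by (auto simp: index_matroid_def)
    then show "\<exists>y\<in>Y - X. insert y X \<in> indep (index_matroid M es)"
      using X Y by (auto simp: index_matroid_def)
  qed (auto simp: index_matroid_def indep_empty intro: indep_hereditary image_mono)
qed

section \<open>Reasoning about programs\<close>

text \<open>A bound on the running time under the assumption that no loop is iterated more than
  \<open>N\<close> times each time it is entered.\<close>

fun cost_bound :: "nat \<Rightarrow> com \<Rightarrow> nat" where
  "cost_bound N Skip = 1"
| "cost_bound N (Assign x i e) = 1 + acost i + acost e"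
| "cost_bound N (Seq c d) = cost_bound N c + cost_bound N d"
| "cost_bound N (If b c d) = 1 + bcost b + cost_bound N c + cost_bound N d"
| "cost_bound N (While b c) = (1 + bcost b + cost_bound N c) * N + (1 + bcost b)"
| "cost_bound N (Query x y) = 1"

text \<open>Only \<open>While\<close> contributes a factor \<open>N\<close>, so the degree is at
  most the nesting depth of the loops. For \<open>If\<close> the bound adds both branches instead of
  taking their maximum, which need not be a polynomial.\<close>

lemma cost_bound_poly: "\<exists>p :: nat poly. \<forall>N. cost_bound N c = poly p N"
proof (induction c)
  case Skip
  then show ?case by (intro exI[of _ "[:1:]"]) simp
next
  case (Assign x i e)
  then show ?case by (intro exI[of _ "[:1 + acost i + acost e:]"]) simp
next
  case (Seq c d)
  then obtain p q where "\<forall>N. cost_bound N c = poly p N" "\<forall>N. cost_bound N d = poly q N" by blast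
  then show ?case by (intro exI[of _ "p + q"]) simp
next
  case (If b c d)
  then obtain p q where "\<forall>N. cost_bound N c = poly p N" "\<forall>N. cost_bound N d = poly q N" by blast
  then show ?case by (intro exI[of _ "[:1 + bcost b:] + p + q"]) simp
next
  case (While b c)
  then obtain p where "\<forall>N. cost_bound N c = poly p N" by blast
  then show ?case
    by (intro exI[of _ "([:1 + bcost b:] + p) * [:0, 1:] + [:1 + bcost b:]"]) (simp add: algebra_simps)
next
  case (Query x y)
  then show ?case by (intro exI[of _ "[:1:]"]) simp
qed

fun modified :: "com \<Rightarrow> string set" where
  "modified Skip = {}"
| "modified (Assign x i e) = {x}"
| "modified (Seq c d) = modified c \<union> modified d"
| "modified (If b c d) = modified c \<union> modified d"
| "modified (While b c) = modified c"
| "modified (Query x y) = {x}"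

lemma exec_unmodified: "exec orc c s t s' \<Longrightarrow> x \<notin> modified c \<Longrightarrow> s' x = s x"
  by (induction rule: exec.induct) auto

text \<open>Termination, running time and postcondition in one predicate. The time bound mentions no
  store, so it composes by itself in the rules below and only loops raise an obligation about
  time.\<close>

definition run :: "nat \<Rightarrow> oracle_fun \<Rightarrow> com \<Rightarrow> store \<Rightarrow> (store \<Rightarrow> bool) \<Rightarrow> bool" where
  "run N orc c s Q \<longleftrightarrow> (\<exists>t s'. exec orc c s t s' \<and> t \<le> cost_bound N c \<and> Q s')"

lemma run_frame:
  assumes "run N orc c s Q" "\<And>s'. Q s' \<Longrightarrow> (\<And>x. x \<notin> modified c \<Longrightarrow> s' x = s x) \<Longrightarrow> R s'"
  shows "run N orc c s R"
proof -
  obtain t s' where "exec orc c s t s'" "t \<le> cost_bound N c" "Q s'"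
    using assms(1) unfolding run_def by blast
  with assms(2)[of s'] exec_unmodified[of orc c s t s'] show ?thesis
    unfolding run_def by blast
qed

lemma run_mono: "run N orc c s Q \<Longrightarrow> (\<And>s'. Q s' \<Longrightarrow> R s') \<Longrightarrow> run N orc c s R"
  by (rule run_frame)

lemma run_Skip: "Q s \<Longrightarrow> run N orc Skip s Q"
  unfolding run_def using exec.Skip[of orc s] by auto

lemma run_Assign: "Q (s(x := (s x)(aval i s := aval e s))) \<Longrightarrow> run N orc (Assign x i e) s Q"
  unfolding run_def using exec.Assign[of orc x i e s] by auto

lemma run_Query:
  "Q (s(x := (s x)(0 := (if orc {i. s y i \<noteq> 0} then 1 else 0)))) \<Longrightarrow> run N orc (Query x y) s Q"
  unfolding run_def using exec.Query[of orc x y s] by auto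

lemma run_Seq: "run N orc c s (\<lambda>s'. run N orc d s' Q) \<Longrightarrow> run N orc (Seq c d) s Q"
  unfolding run_def cost_bound.simps using exec.Seq add_mono by meson

lemma run_If:
  assumes "bval b s \<Longrightarrow> run N orc c s Q" "\<not> bval b s \<Longrightarrow> run N orc d s Q"
  shows "run N orc (If b c d) s Q"
proof (cases "bval b s")
  case True
  then obtain t s' where "exec orc c s t s'" "t \<le> cost_bound N c" "Q s'"
    using assms unfolding run_def by blast
  with exec.IfTrue[OF True this(1), of d] show ?thesis
    unfolding run_def by (intro exI[of _ "1 + bcost b + t"] exI[of _ s']) auto
next
  case False
  then obtain t s' where "exec orc d s t s'" "t \<le> cost_bound N d" "Q s'"
    using assms unfolding run_def by blast
  with exec.IfFalse[OF False this(1), of c] show ?thesis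
    unfolding run_def by (intro exI[of _ "1 + bcost b + t"] exI[of _ s']) auto
qed

lemmas run_intros = run_Skip run_Assign run_Query run_Seq run_If

text \<open>The measure bounds the number of rounds still to come. The induction therefore keeps
  \<open>m s\<close> in the time bound, with one last failing test on top, and replaces it by
  \<open>N\<close> only at the end.\<close>

lemma run_While:
  fixes m :: "store \<Rightarrow> nat"
  assumes body: "\<And>s. I s \<Longrightarrow> bval b s \<Longrightarrow> run N orc c s (\<lambda>s'. I s' \<and> m s' < m s)"
    and "I s" "m s \<le> N"
  shows "run N orc (While b c) s (\<lambda>s'. I s' \<and> \<not> bval b s')"
proof -
  have "\<exists>t s'. exec orc (While b c) s t s' \<and>
      t \<le> (1 + bcost b + cost_bound N c) * m s + (1 + bcost b) \<and> I s' \<and> \<not> bval b s'"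
    using \<open>I s\<close>
  proof (induction "m s" arbitrary: s rule: less_induct)
    case less
    show ?case
    proof (cases "bval b s")
      case False
      then show ?thesis using exec.WhileFalse[OF False, of orc c] less.prems
        by (intro exI[of _ "1 + bcost b"] exI[of _ s]) auto
    next
      case True
      obtain t1 s1 where 1: "exec orc c s t1 s1" "t1 \<le> cost_bound N c" "I s1" "m s1 < m s"
        using body[OF less.prems True] unfolding run_def by blast
      obtain t2 s2 where 2: "exec orc (While b c) s1 t2 s2"
        "t2 \<le> (1 + bcost b + cost_bound N c) * m s1 + (1 + bcost b)" "I s2" "\<not> bval b s2"
        using less.hyps[OF 1(4,3)] by blast
      have "(1 + bcost b + cost_bound N c) * Suc (m s1) \<le> (1 + bcost b + cost_bound N c) * m s"
        using 1(4) by (intro mult_le_mono2) simp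
      then have "1 + bcost b + t1 + t2 \<le> (1 + bcost b + cost_bound N c) * m s + (1 + bcost b)"
        using 1(2) 2(2) by simp
      then show ?thesis using exec.WhileTrue[OF True 1(1) 2(1)] 2(3,4) by blast
    qed
  qed
  moreover have "(1 + bcost b + cost_bound N c) * m s \<le> (1 + bcost b + cost_bound N c) * N"
    using \<open>m s \<le> N\<close> by (intro mult_le_mono2)
  ultimately show ?thesis unfolding run_def cost_bound.simps by (meson add_le_mono1 le_trans)
qed

abbreviation Var :: "string \<Rightarrow> aexp" where
  "Var x \<equiv> Cell x (Const 0)"

definition For :: "string \<Rightarrow> aexp \<Rightarrow> com \<Rightarrow> com" where
  "For x e c = Seq (Assign x (Const 0) (Const 0))
     (While (Less (Var x) e) (Seq c (Assign x (Const 0) (Plus (Var x) (Const 1)))))"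

lemma modified_For [simp]: "modified (For x e c) = insert x (modified c)"
  by (auto simp: For_def)

lemma oracle_free_For [simp]: "oracle_free (For x e c) \<longleftrightarrow> oracle_free c"
  by (auto simp: For_def)

text \<open>The bound \<open>e\<close> is evaluated again in every round; the first hypothesis says
  that it depends only on cells that the loop leaves alone. The invariant is stated for the store in
  which the counter has already been advanced.\<close>

lemma run_For:
  assumes K: "\<And>s'. (\<And>y. y \<noteq> x \<Longrightarrow> y \<notin> modified c \<Longrightarrow> s' y = s y) \<Longrightarrow> aval e s' = K"
    and le: "K \<le> N" and x: "x \<notin> modified c"
    and init: "P 0 (s(x := (s x)(0 := 0)))"
    and body: "\<And>i s'. i < K \<Longrightarrow> s' x 0 = i \<Longrightarrow> P i s' \<Longrightarrow>
      (\<And>y. y \<noteq> x \<Longrightarrow> y \<notin> modified c \<Longrightarrow> s' y = s y) \<Longrightarrow>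
      run N orc c s' (\<lambda>s''. P (Suc i) (s''(x := (s'' x)(0 := Suc i))))"
    and post: "\<And>s'. P K s' \<Longrightarrow> (\<And>y. y \<noteq> x \<Longrightarrow> y \<notin> modified c \<Longrightarrow> s' y = s y) \<Longrightarrow> Q s'"
  shows "run N orc (For x e c) s Q"
proof -
  let ?I = "\<lambda>s'. P (s' x 0) s' \<and> s' x 0 \<le> K \<and>
    (\<forall>y. y \<noteq> x \<longrightarrow> y \<notin> modified c \<longrightarrow> s' y = s y)"
  let ?c = "Seq c (Assign x (Const 0) (Plus (Var x) (Const 1)))"
  have step: "run N orc ?c s' (\<lambda>s''. ?I s'' \<and> K - s'' x 0 < K - s' x 0)"
    if I: "?I s'" and b: "bval (Less (Var x) e) s'" for s'
  proof -
    have lt: "s' x 0 < K" using K[of s'] I b by auto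
    show ?thesis
    proof (rule run_Seq, rule run_frame)
      show "run N orc c s' (\<lambda>s''. P (Suc (s' x 0)) (s''(x := (s'' x)(0 := Suc (s' x 0)))))"
        using body[of "s' x 0" s'] lt I by blast
      fix s'' assume "P (Suc (s' x 0)) (s''(x := (s'' x)(0 := Suc (s' x 0))))"
        and "\<And>y. y \<notin> modified c \<Longrightarrow> s'' y = s' y"
      then show "run N orc (Assign x (Const 0) (Plus (Var x) (Const 1))) s''
          (\<lambda>s''. ?I s'' \<and> K - s'' x 0 < K - s' x 0)"
        using I x lt by (intro run_Assign) auto
    qed
  qed
  show ?thesis unfolding For_def
  proof (rule run_Seq, rule run_Assign)
    show "run N orc (While (Less (Var x) e) ?c)
        (s(x := (s x)(aval (Const 0) s := aval (Const 0) s))) Q"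
    proof (rule run_mono[OF run_While[where I = ?I and m = "\<lambda>s'. K - s' x 0"]])
      fix s' assume "?I s' \<and> \<not> bval (Less (Var x) e) s'"
      then have "P (s' x 0) s'" "s' x 0 = K" "\<And>y. y \<noteq> x \<Longrightarrow> y \<notin> modified c \<Longrightarrow> s' y = s y"
        using K[of s'] by auto
      then show "Q s'" using post[of s'] by blast
    qed (use step init le in auto)
  qed
qed

section \<open>Matroid partition\<close>

text \<open>Instantiated below with the dual of a bridgeless matroid and with the cographic matroid
  of a 2-edge-connected graph. Being loopless is what the absence of bridges gives.\<close>

locale loopless_nat_matroid = matroid M for M :: "nat set_system" +
  fixes n :: nat
  assumes ground_eq: "ground M = {..<n}"
    and singleton_indep: "i < n \<Longrightarrow> {i} \<in> indep M"
begin

definition proper :: "(nat \<Rightarrow> 'c) \<Rightarrow> bool" where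
  "proper g \<longleftrightarrow> (\<forall>i<n. {w. w < n \<and> g w = g i} \<in> indep M)"

text \<open>Colors are positive and color 0 marks an uncolored element. The positions \<open>n, \<dots>, n + k - 1\<close>
  are dummies, one for each color in use; recoloring \<open>z\<close> through a dummy adds \<open>z\<close> to
  the color class and removes nothing from it.\<close>

definition arc :: "(nat \<Rightarrow> nat) \<Rightarrow> nat \<Rightarrow> nat \<Rightarrow> bool" where
  "arc f z y \<longleftrightarrow> f y \<noteq> 0 \<and> f y \<noteq> f z \<and> insert z {w. w < n \<and> f w = f y \<and> w \<noteq> y} \<in> indep M"

text \<open>\<open>lev z\<close> is one more than the length of a shortest path of arcs from \<open>z\<close> to a dummy, and 0
  if there is none; \<open>nxt z\<close> is the second vertex of such a path.\<close>

definition levels :: "(nat \<Rightarrow> nat) \<Rightarrow> nat \<Rightarrow> (nat \<Rightarrow> nat) \<Rightarrow> (nat \<Rightarrow> nat) \<Rightarrow> bool" where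
  "levels f k lev nxt \<longleftrightarrow> (\<forall>i<k. lev (n + i) = 1) \<and> (\<forall>z<n. lev z \<le> n + 2) \<and>
    (\<forall>z<n. lev z > 0 \<longrightarrow> nxt z < n + k \<and> arc f z (nxt z) \<and> lev (nxt z) > 0 \<and>
       lev z = Suc (lev (nxt z))) \<and>
    (\<forall>z<n. \<forall>y<n + k. arc f z y \<longrightarrow> lev y > 0 \<longrightarrow> lev z > 0 \<and> lev z \<le> Suc (lev y))"

definition partial_coloring :: "(nat \<Rightarrow> nat) \<Rightarrow> nat \<Rightarrow> bool" where
  "partial_coloring f k \<longleftrightarrow> (\<forall>i<k. f (n + i) = Suc i) \<and> (\<forall>z<n. f z \<le> k) \<and>
    (\<forall>c. 1 \<le> c \<and> c \<le> k \<longrightarrow> {w. w < n \<and> f w = c} \<in> indep M)"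

text \<open>The optimality certificate carried through the run: color \<open>k\<close> is opened
  only after fewer than \<open>k\<close> colors have been shown not to suffice.\<close>

definition lower_bound :: "nat \<Rightarrow> bool" where
  "lower_bound k \<longleftrightarrow> (\<forall>g :: nat \<Rightarrow> nat. proper g \<longrightarrow> k \<le> card (g ` {..<n}))"

definition recolor :: "(nat \<Rightarrow> nat) \<Rightarrow> nat \<Rightarrow> nat \<Rightarrow> nat \<Rightarrow> nat" where
  "recolor f x y = (if y < n then f(x := f y, y := 0) else f(x := f y))"

lemma proper_id: "proper (\<lambda>i. i)"
proof -
  have "{w. w < n \<and> w = i} = {i}" if "i < n" for i using that by auto
  then show ?thesis using singleton_indep by (simp add: proper_def)
qed

text \<open>Singletons are independent, so \<open>n\<close> colors always suffice. This keeps the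
  number of positions, dummies included, at most 2 n.\<close>

lemma lower_bound_le: "lower_bound k \<Longrightarrow> k \<le> n"
  using proper_id unfolding lower_bound_def by force

lemma recolor_partial_coloring:
  assumes f: "partial_coloring f k" and x: "x < n" "f x = 0" and y: "y < n + k" and arc: "arc f x y"
  shows "partial_coloring (recolor f x y) k"
proof -
  have fy: "f y \<noteq> 0" "f y \<le> k" "x \<noteq> y"
    using f y arc x by (auto simp: arc_def partial_coloring_def)
       (metis add_diff_inverse_nat add_less_cancel_left Suc_leI not_less)
  have "{w. w < n \<and> recolor f x y w = c} \<in> indep M" if c: "1 \<le> c" "c \<le> k" for c
  proof (cases "c = f y")
    case True
    have "{w. w < n \<and> recolor f x y w = c} \<subseteq> insert x {w. w < n \<and> f w = f y \<and> w \<noteq> y}"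
      using True x c by (auto simp: recolor_def split: if_splits)
    then show ?thesis using arc indep_hereditary unfolding arc_def by blast
  next
    case False
    have "{w. w < n \<and> recolor f x y w = c} \<subseteq> {w. w < n \<and> f w = c}"
      using False c by (auto simp: recolor_def split: if_splits)
    then show ?thesis using f c indep_hereditary unfolding partial_coloring_def by blast
  qed
  then show ?thesis
    using f x y fy unfolding partial_coloring_def by (auto simp: recolor_def)
qed

text \<open>Shortest paths from \<open>y\<close> to a dummy survive the exchange, so the new level
  of \<open>y\<close> is at most its old one, which is one less than that of \<open>x\<close>. Only
  arcs into the class of \<open>y\<close> are in doubt, and for these \<open>indep_exchange\<close>
  replaces \<open>y\<close> by \<open>x\<close> in the class enlarged by \<open>z\<close>.\<close>

lemma recolor_levels:
  assumes f: "partial_coloring f k" and x: "x < n" "f x = 0"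
    and lev: "levels f k lev nxt" "lev x > 0"
    and lev': "levels (recolor f x (nxt x)) k lev' nxt'"
  shows "0 < lev' (nxt x) \<and> lev' (nxt x) < lev x"
proof -
  define y where "y = nxt x"
  define f' where "f' = recolor f x y"
  have y: "y < n + k" "arc f x y" "lev y > 0" "lev x = Suc (lev y)"
    using lev x unfolding levels_def y_def by auto
  have xy: "x \<noteq> y" using y(4) by auto
  \<comment> \<open>The claim for \<open>y\<close> is generalized to all positions of smaller level,
    since these are what a shortest path from \<open>y\<close> visits.\<close>
  have "0 < lev' z \<and> lev' z \<le> lev z"
    if "z < n + k" "0 < lev z" "z = y \<or> lev z < lev y" for z
    using that
  proof (induction "lev z" arbitrary: z rule: less_induct)
    case less
    show ?case
    proof (cases "z < n")
      case False
      then obtain i where "z = n + i" "i < k" using less.prems(1) less_eqE by (metis add_less_cancel_left not_less)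
      then show ?thesis using lev(1) lev' unfolding levels_def by simp
    next
      case True
      define z' where "z' = nxt z"
      have z': "z' < n + k" "arc f z z'" "lev z' > 0" "lev z = Suc (lev z')"
        using lev(1) True less.prems(2) unfolding levels_def z'_def by auto
      have lt: "lev z' < lev y" using z'(4) less.prems(3) by auto
      have IH: "0 < lev' z'" "lev' z' \<le> lev z'"
        using less.hyps[of z'] z' lt by auto
      have ne: "z \<noteq> x" "z' \<noteq> x" "z' \<noteq> y" using lt less.prems(3) y(4) xy by auto
      have f'z': "f' z' = f z'" using ne by (simp add: f'_def recolor_def)
      have fz: "f z' \<noteq> 0" "f z' \<noteq> f z" using z'(2) by (auto simp: arc_def)
      have "f' z' \<noteq> f' z" using fz f'z' ne by (auto simp: f'_def recolor_def)
      moreover have "insert z {w. w < n \<and> f' w = f' z' \<and> w \<noteq> z'} \<in> indep M"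
      proof (cases "f z' = f y")
        case False
        then have "{w. w < n \<and> f' w = f' z' \<and> w \<noteq> z'} \<subseteq> {w. w < n \<and> f w = f z' \<and> w \<noteq> z'}"
          using fz f'z' by (auto simp: f'_def recolor_def split: if_splits)
        then show ?thesis
          using z'(2) indep_hereditary unfolding arc_def by (meson insert_mono)
      next
        case True
        define I where "I = {w. w < n \<and> f w = f z' \<and> w \<noteq> z'}"
        have zI: "insert z I \<in> indep M" using z'(2) by (simp add: arc_def I_def)
        have zy: "z \<noteq> y" using fz True by auto
        \<comment> \<open>Such an arc would give \<open>lev x \<le> Suc (lev z')\<close>, while
          \<open>lev z' < lev y\<close> and \<open>lev x = Suc (lev y)\<close>.\<close>
        have "\<not> arc f x z'"
          using lev(1) x(1) z'(1,3) lt y(4) unfolding levels_def by fastforce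
        then have xI: "insert x I \<notin> indep M" using fz x by (simp add: arc_def I_def)
        show ?thesis
        proof (cases "y < n")
          case yn: True
          have yI: "y \<in> I" using yn True ne by (simp add: I_def)
          have "insert x (I - {y}) \<subseteq> insert x {w. w < n \<and> f w = f y \<and> w \<noteq> y}"
            using True by (auto simp: I_def)
          then have "insert x (I - {y}) \<in> indep M"
            using y(2) indep_hereditary unfolding arc_def by blast
          then have "insert x (insert z I - {y}) \<in> indep M"
            using indep_exchange[OF zI _ yI xI] by blast
          moreover have "insert z {w. w < n \<and> f' w = f' z' \<and> w \<noteq> z'} \<subseteq> insert x (insert z I - {y})"
            using zy f'z' fz yn by (auto simp: I_def f'_def recolor_def split: if_splits)
          ultimately show ?thesis using indep_hereditary by blast
        next
          case False
          \<comment> \<open>If \<open>y\<close> is a dummy, its arc says that \<open>x\<close> fits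
            into the entire class, so \<open>insert x I\<close> would be independent: this case is
            impossible.\<close>
          have "insert x I \<subseteq> insert x {w. w < n \<and> f w = f y \<and> w \<noteq> y}"
            using True False by (auto simp: I_def)
          then show ?thesis using xI y(2) indep_hereditary unfolding arc_def by blast
        qed
      qed
      ultimately have "arc f' z z'" using fz f'z' by (simp add: arc_def)
      then have "lev' z > 0 \<and> lev' z \<le> Suc (lev' z')"
        using lev' True z'(1) IH unfolding levels_def f'_def y_def by blast
      then show ?thesis using IH z'(4) by auto
    qed
  qed
  from this[of y] show ?thesis using y by (auto simp: y_def)
qed

text \<open>With \<open>m\<close> the rank of \<open>A\<close>, every color class \<open>I\<close>
  meets \<open>A\<close> in exactly \<open>m\<close> elements: an unreachable \<open>z\<close> has
  no arc to the dummy of the class nor to a reachable member of it, so by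
  \<open>dep_of_no_exchange\<close> the set \<open>A \<inter> I\<close> cannot be extended inside
  \<open>A\<close>. Together with \<open>x\<close> this gives \<open>k * m + 1\<close> elements,
  whereas each class of a proper coloring covers at most \<open>m\<close> of them.\<close>

lemma unreachable_lower_bound:
  assumes f: "partial_coloring f k" and x: "x < n" "f x = 0"
    and lev: "levels f k lev nxt" "lev x = 0"
  shows "lower_bound (Suc k)"
  unfolding lower_bound_def
proof (intro allI impI)
  fix g :: "nat \<Rightarrow> nat" assume g: "proper g"
  define A where "A = {z. z < n \<and> lev z = 0 \<and> (f z \<noteq> 0 \<or> z = x)}"
  define m where "m = Max (card ` {I \<in> indep M. I \<subseteq> A})"
  have fin: "finite (card ` {I \<in> indep M. I \<subseteq> A})" using finite_indep_sets by simp
  have finA: "finite A" by (simp add: A_def)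
  have le_m: "card I \<le> m" if "I \<in> indep M" "I \<subseteq> A" for I
    unfolding m_def using that fin by (intro Max_ge) auto
  have "m \<in> card ` {I \<in> indep M. I \<subseteq> A}"
    unfolding m_def using fin indep_empty by (intro Max_in) auto
  then obtain S where S: "S \<in> indep M" "S \<subseteq> A" "card S = m" by auto
  have card_class: "card (A \<inter> {w. f w = c}) = m" if c: "1 \<le> c" "c \<le> k" for c
  proof (rule antisym)
    define I where "I = {w. w < n \<and> f w = c}"
    have I: "I \<in> indep M" using f c by (auto simp: partial_coloring_def I_def)
    have AI: "A \<inter> {w. f w = c} = A \<inter> I" by (auto simp: A_def I_def)
    have J: "A \<inter> I \<in> indep M" using I indep_hereditary by blast
    then show "card (A \<inter> {w. f w = c}) \<le> m" using le_m AI by simp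
    show "m \<le> card (A \<inter> {w. f w = c})"
    proof (rule ccontr)
      assume "\<not> m \<le> card (A \<inter> {w. f w = c})"
      then obtain z where z: "z \<in> S - A \<inter> I" "insert z (A \<inter> I) \<in> indep M"
        using indep_augment[OF J S(1)] S(3) AI by auto
      have zA: "z < n" "lev z = 0" "f z \<noteq> c" using z(1) S(2) by (auto simp: A_def I_def)
      have no_arc: "\<not> arc f z y" if "y < n + k" "lev y > 0" for y
        using lev(1) zA that unfolding levels_def by fastforce
      \<comment> \<open>The dummy of color \<open>c\<close>; the shift by one comes from reserving
        color 0 for uncolored elements.\<close>
      define d where "d = n + (c - 1)"
      have d: "d < n + k" "f d = c" "lev d = 1" "\<not> d < n"
      proof -
        have "c - 1 < k" "Suc (c - 1) = c" using c by auto
        then show "d < n + k" "f d = c" "lev d = 1" "\<not> d < n"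
          using f lev(1) by (auto simp: d_def partial_coloring_def levels_def simp del: One_nat_def)
      qed
      have "{w. w < n \<and> f w = f d \<and> w \<noteq> d} = I" using d by (auto simp: I_def)
      then have "insert z I \<notin> indep M" using no_arc[of d] d zA(3) c by (simp add: arc_def)
      moreover have "insert z (I - {y}) \<notin> indep M" if y: "y \<in> I - A \<inter> I" for y
      proof -
        have "y < n" "f y = c" "lev y > 0" using y c by (auto simp: A_def I_def)
        moreover have "{w. w < n \<and> f w = f y \<and> w \<noteq> y} = I - {y}"
          using \<open>f y = c\<close> by (auto simp: I_def)
        ultimately show ?thesis using no_arc[of y] zA(3) c by (simp add: arc_def)
      qed
      ultimately show False using dep_of_no_exchange[OF I, of "A \<inter> I" z] z(2) by blast
    qed
  qed
  have "A = insert x (\<Union>c\<in>{1..k}. A \<inter> {w. f w = c})"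
    using f x lev(2) by (auto simp: A_def partial_coloring_def Suc_le_eq)
  moreover have "x \<notin> (\<Union>c\<in>{1..k}. A \<inter> {w. f w = c})" using x by auto
  moreover have "card (\<Union>c\<in>{1..k}. A \<inter> {w. f w = c}) = (\<Sum>c\<in>{1..k}. card (A \<inter> {w. f w = c}))"
    using finA by (intro card_UN_disjoint) auto
  ultimately have "card A = Suc (k * m)"
    using finA card_class by (metis (no_types, lifting) card_insert_disjoint finite_insert
        atLeastAtMost_iff card_atLeastAtMost diff_Suc_1 sum_constant sum.cong mult.commute of_nat_id)
  moreover have "card A \<le> card (g ` {..<n}) * m"
  proof -
    have "A = (\<Union>c\<in>g ` {..<n}. A \<inter> {w. g w = c})" by (auto simp: A_def)
    then have "card A \<le> (\<Sum>c\<in>g ` {..<n}. card (A \<inter> {w. g w = c}))"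
      by (metis card_UN_le finite_imageI finite_lessThan)
    also have "\<dots> \<le> (\<Sum>c\<in>g ` {..<n}. m)"
    proof (rule sum_mono)
      fix c assume "c \<in> g ` {..<n}"
      then have "{w. w < n \<and> g w = c} \<in> indep M" using g by (auto simp: proper_def)
      then have "A \<inter> {w. g w = c} \<in> indep M"
        by (rule indep_hereditary) (auto simp: A_def)
      then show "card (A \<inter> {w. g w = c}) \<le> m" by (rule le_m) simp
    qed
    finally show ?thesis by simp
  qed
  ultimately have "k * m < card (g ` {..<n}) * m" by linarith
  then show "Suc k \<le> card (g ` {..<n})" by simp
qed

lemma new_color_partial_coloring:
  assumes "partial_coloring f k" "x < n" "f x = 0"
  shows "partial_coloring (f(n + k := Suc k, x := Suc k)) (Suc k)"
proof -
  let ?f = "f(n + k := Suc k, x := Suc k)"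
  have "{w. w < n \<and> ?f w = c} \<in> indep M" if c: "1 \<le> c" "c \<le> Suc k" for c
  proof (cases "c = Suc k")
    case True
    then have "{w. w < n \<and> ?f w = c} = {x}"
      using assms by (auto simp: partial_coloring_def)
    then show ?thesis using singleton_indep assms by simp
  next
    case False
    then have "{w. w < n \<and> ?f w = c} \<subseteq> {w. w < n \<and> f w = c}" by auto
    moreover have "{w. w < n \<and> f w = c} \<in> indep M"
      using assms(1) False c by (simp add: partial_coloring_def)
    ultimately show ?thesis using indep_hereditary by blast
  qed
  then show ?thesis using assms by (auto simp: partial_coloring_def less_Suc_eq le_Suc_eq)
qed

lemma proper_of_partial_coloring:
  assumes "partial_coloring f k" "\<And>z. z < n \<Longrightarrow> f z \<noteq> 0" "lower_bound k" "proper (g :: nat \<Rightarrow> nat)"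
  shows "proper f" "card (f ` {..<n}) \<le> card (g ` {..<n})"
proof -
  show "proper f" using assms(1,2) by (auto simp: proper_def partial_coloring_def Suc_le_eq)
  have "f ` {..<n} \<subseteq> {1..k}" using assms(1,2) by (auto simp: partial_coloring_def Suc_le_eq)
  then have "card (f ` {..<n}) \<le> k" by (metis card_atLeastAtMost card_mono diff_Suc_1 finite_atLeastAtMost)
  also have "k \<le> card (g ` {..<n})" using assms(3,4) by (auto simp: lower_bound_def)
  finally show "card (f ` {..<n}) \<le> card (g ` {..<n})" .
qed

end

section \<open>The partition program\<close>

definition build_set :: com where
  "build_set = Seq
     (For ''i'' (Var ''N'')
       (If (And (Equal (Cell ''f'' (Var ''i'')) (Cell ''f'' (Var ''q''))) (Not (Equal (Var ''i'') (Var ''q''))))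
         (Assign ''y'' (Var ''i'') (Const 1))
         (Assign ''y'' (Var ''i'') (Const 0))))
     (Assign ''y'' (Var ''z'') (Const 1))"

text \<open>The program \<open>T\<close> is an independence test to be supplied: it reads the set
  marked in \<open>y\<close> and answers in cell 0 of \<open>r\<close>. The two color conditions of
  \<open>arc\<close> are checked directly and only the third needs \<open>T\<close>. With
  \<open>T\<close> as a parameter the same code serves matroids and graphs.\<close>

definition check_arc :: "com \<Rightarrow> com" where
  "check_arc T =
     If (And (Equal (Cell ''lev'' (Var ''q'')) (Var ''l''))
          (And (Not (Equal (Cell ''f'' (Var ''q'')) (Const 0)))
            (Not (Equal (Cell ''f'' (Var ''q'')) (Cell ''f'' (Var ''z''))))))
       (Seq build_set (Seq T
         (If (Equal (Var ''r'') (Const 1))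
           (Seq (Assign ''lev'' (Var ''z'') (Plus (Var ''l'') (Const 1)))
             (Seq (Assign ''nxt'' (Var ''z'') (Var ''q'')) (Assign ''ch'' (Const 0) (Const 1))))
           Skip)))
       Skip"

definition scan_element :: "com \<Rightarrow> com" where
  "scan_element T = If (Equal (Cell ''lev'' (Var ''z'')) (Const 0))
     (For ''q'' (Plus (Var ''N'') (Var ''k'')) (check_arc T)) Skip"

definition next_level :: "com \<Rightarrow> com" where
  "next_level T = Seq (Assign ''ch'' (Const 0) (Const 0))
     (Seq (For ''z'' (Var ''N'') (scan_element T))
       (Assign ''l'' (Const 0) (Plus (Var ''l'') (Const 1))))"

text \<open>Breadth-first search against the direction of the arcs, starting from the dummies.
  \<open>l\<close> is the level being expanded and \<open>ch\<close> records whether the last round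
  labelled anything.\<close>

definition compute_levels :: "com \<Rightarrow> com" where
  "compute_levels T =
     Seq (For ''z'' (Var ''N'') (Assign ''lev'' (Var ''z'') (Const 0)))
    (Seq (For ''q'' (Var ''k'') (Assign ''lev'' (Plus (Var ''N'') (Var ''q'')) (Const 1)))
    (Seq (Assign ''l'' (Const 0) (Const 1))
    (Seq (Assign ''ch'' (Const 0) (Const 1))
         (While (Equal (Var ''ch'') (Const 1)) (next_level T)))))"

text \<open>If \<open>q\<close> is a dummy it keeps its color, and \<open>x\<close> becomes a
  position beyond the elements, which is what ends the loop in
  \<open>insert_element\<close>.\<close>

definition shift_coloring :: "com \<Rightarrow> com" where
  "shift_coloring T =
     Seq (Assign ''q'' (Const 0) (Cell ''nxt'' (Var ''x'')))
    (Seq (Assign ''f'' (Var ''x'') (Cell ''f'' (Var ''q'')))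
    (Seq (If (Less (Var ''q'') (Var ''N'')) (Assign ''f'' (Var ''q'') (Const 0)) Skip)
    (Seq (Assign ''x'' (Const 0) (Var ''q''))
         (compute_levels T))))"

definition insert_element :: "com \<Rightarrow> com" where
  "insert_element T =
     Seq (Assign ''x'' (Const 0) (Var ''j''))
    (Seq (compute_levels T)
    (Seq (While (And (Less (Var ''x'') (Var ''N'')) (Less (Const 0) (Cell ''lev'' (Var ''x''))))
           (shift_coloring T))
         (If (Less (Var ''x'') (Var ''N''))
           (Seq (Assign ''f'' (Plus (Var ''N'') (Var ''k'')) (Plus (Var ''k'') (Const 1)))
           (Seq (Assign ''k'' (Const 0) (Plus (Var ''k'') (Const 1)))
                (Assign ''f'' (Var ''x'') (Var ''k''))))
           Skip)))"

definition partition :: "com \<Rightarrow> com" where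
  "partition T = For ''j'' (Var ''N'') (insert_element T)"

lemmas program_defs = build_set_def check_arc_def scan_element_def next_level_def
  compute_levels_def shift_coloring_def insert_element_def partition_def

text \<open>Arrays that the partition program never writes, so preconditions of the independence
  test may refer to them.\<close>

definition input_names :: "string set" where
  "input_names = {''N'', ''n'', ''m'', ''u'', ''w''}"

definition scratch_names :: "string set" where
  "scratch_names = {''r'', ''ta'', ''tb'', ''tc'', ''td''}"

text \<open>By \<open>Pre_cong\<close> the precondition of \<open>T\<close> depends on the input
  arrays only, hence persists through the run. The bound on \<open>N\<close> fits every loop: a scan
  visits n + k \<le> 2 n positions, the search makes at most n + 1 rounds, and the exchanges for one
  element are bounded by its level, at most n + 2.\<close>

locale partition_program = loopless_nat_matroid +
  fixes N :: nat and orc :: oracle_fun and T :: com and Pre :: "store \<Rightarrow> bool"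
  assumes N_ge: "2 * n + 3 \<le> N"
    and T_modified: "modified T \<subseteq> scratch_names"
    and Pre_n: "Pre s \<Longrightarrow> s ''N'' 0 = n"
    and Pre_cong: "Pre s \<Longrightarrow> (\<And>x. x \<in> input_names \<Longrightarrow> s' x = s x) \<Longrightarrow> Pre s'"
    and T_run: "Pre s \<Longrightarrow> run N orc T s
      (\<lambda>s'. s' ''r'' 0 = (if {i. i < n \<and> s ''y'' i \<noteq> 0} \<in> indep M then 1 else 0))"
begin

lemma T_unmodified [simp]: "x \<notin> scratch_names \<Longrightarrow> x \<notin> modified T"
  using T_modified by auto

lemma T_input [simp]: "x \<in> input_names \<Longrightarrow> x \<notin> modified T"
  by (rule T_unmodified) (auto simp: input_names_def scratch_names_def)

lemma run_build_set:
  assumes "s ''N'' 0 = n" "s ''z'' 0 < n"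
  shows "run N orc build_set s (\<lambda>s'. {i. i < n \<and> s' ''y'' i \<noteq> 0} =
    insert (s ''z'' 0) {w. w < n \<and> s ''f'' w = s ''f'' (s ''q'' 0) \<and> w \<noteq> s ''q'' 0})"
  unfolding build_set_def
proof (rule run_Seq, rule run_For[where K = n and P = "\<lambda>i s'. \<forall>w<i. s' ''y'' w \<noteq> 0 \<longleftrightarrow>
      (s ''f'' w = s ''f'' (s ''q'' 0) \<and> w \<noteq> s ''q'' 0)"], goal_cases)
  case (5 i s')
  then show ?case by (intro run_intros) (auto simp: less_Suc_eq)
next
  case (6 s')
  then show ?case using assms by (intro run_intros) auto
qed (use assms N_ge in auto)

lemma run_check_arc:
  assumes "Pre s" "s ''z'' 0 < n"
  defines "z \<equiv> s ''z'' 0" and "q \<equiv> s ''q'' 0"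
  shows "run N orc (check_arc T) s (\<lambda>s'.
    if s ''lev'' q = s ''l'' 0 \<and> arc (s ''f'') z q
    then s' ''lev'' = (s ''lev'')(z := Suc (s ''l'' 0)) \<and> s' ''nxt'' = (s ''nxt'')(z := q) \<and>
         s' ''ch'' 0 = 1
    else s' ''lev'' = s ''lev'' \<and> s' ''nxt'' = s ''nxt'' \<and> s' ''ch'' 0 = s ''ch'' 0)"
  unfolding check_arc_def
proof (rule run_If, goal_cases)
  case guard: 1
  let ?A = "insert z {w. w < n \<and> s ''f'' w = s ''f'' q \<and> w \<noteq> q}"
  show ?case
  proof (rule run_Seq, rule run_frame[OF run_build_set], goal_cases)
    case (3 s1)
    have Pre: "Pre s1"
      by (rule Pre_cong[OF assms(1)], rule 3(2)) (auto simp: input_names_def build_set_def)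
    have 4: "s1 ''lev'' = s ''lev''" "s1 ''nxt'' = s ''nxt''" "s1 ''ch'' = s ''ch''" "s1 ''l'' = s ''l''"
      "s1 ''q'' = s ''q''" "s1 ''z'' = s ''z''"
      by (simp_all add: 3(2) build_set_def)
    show ?case
    proof (rule run_Seq, rule run_frame[OF T_run[OF Pre]], goal_cases)
      case (1 s2)
      have 5: "s2 ''lev'' = s ''lev''" "s2 ''nxt'' = s ''nxt''" "s2 ''ch'' = s ''ch''" "s2 ''l'' = s ''l''"
        "s2 ''q'' = s ''q''" "s2 ''z'' = s ''z''"
        by (simp_all add: 1(2) 4 scratch_names_def)
      have r: "s2 ''r'' 0 = (if ?A \<in> indep M then 1 else 0)" using 1(1) 3(1) by (simp add: z_def q_def)
      have arc: "s ''lev'' q = s ''l'' 0" "arc (s ''f'') z q \<longleftrightarrow> ?A \<in> indep M"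
        using guard by (auto simp: arc_def z_def q_def)
      show ?case
      proof (cases "?A \<in> indep M")
        case True
        show ?thesis by (intro run_intros) (simp_all add: r arc True 5 flip: z_def q_def)
      next
        case False
        show ?thesis by (intro run_intros) (simp_all add: r arc False 5 flip: z_def q_def)
      qed
    qed
  qed (use assms Pre_n in auto)
next
  case 2
  then show ?case by (intro run_intros) (auto simp: arc_def z_def q_def)
qed

lemma run_scan_element:
  assumes "Pre s" "s ''z'' 0 < n" "s ''l'' 0 \<ge> 1" "s ''k'' 0 \<le> n"
  defines "z \<equiv> s ''z'' 0" and "l \<equiv> s ''l'' 0"
  shows "run N orc (scan_element T) s (\<lambda>s'.
    if s ''lev'' z = 0 \<and> (\<exists>y<n + s ''k'' 0. s ''lev'' y = l \<and> arc (s ''f'') z y)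
    then s' ''lev'' = (s ''lev'')(z := Suc l) \<and> s' ''ch'' 0 = 1 \<and>
      (\<exists>y<n + s ''k'' 0. s ''lev'' y = l \<and> arc (s ''f'') z y \<and> s' ''nxt'' = (s ''nxt'')(z := y))
    else s' ''lev'' = s ''lev'' \<and> s' ''nxt'' = s ''nxt'' \<and> s' ''ch'' 0 = s ''ch'' 0)"
  unfolding scan_element_def
proof (rule run_If, goal_cases)
  case 1
  let ?P = "\<lambda>i s'. if \<exists>y<i. s ''lev'' y = l \<and> arc (s ''f'') z y
    then s' ''lev'' = (s ''lev'')(z := Suc l) \<and> s' ''ch'' 0 = 1 \<and>
      (\<exists>y<i. s ''lev'' y = l \<and> arc (s ''f'') z y \<and> s' ''nxt'' = (s ''nxt'')(z := y))
    else s' ''lev'' = s ''lev'' \<and> s' ''nxt'' = s ''nxt'' \<and> s' ''ch'' 0 = s ''ch'' 0"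
  have z0: "s ''lev'' z = 0" using 1 by (simp add: z_def)
  show ?case
  proof (rule run_For[where K = "n + s ''k'' 0" and P = ?P], goal_cases)
    case (5 i s')
    have same: "s' ''f'' = s ''f''" "s' ''z'' = s ''z''" "s' ''l'' = s ''l''"
      by (simp_all add: 5(4) check_arc_def build_set_def scratch_names_def)
    have Pre: "Pre s'"
      by (rule Pre_cong[OF assms(1)], rule 5(4))
        (auto simp: input_names_def check_arc_def build_set_def scratch_names_def)
    \<comment> \<open>Only the entry of \<open>z\<close> can have changed, from 0 to
      \<open>Suc l\<close>; neither value is \<open>l\<close>, so the test for level
      \<open>l\<close> is not disturbed.\<close>
    have lev_i: "s' ''lev'' i = l \<longleftrightarrow> s ''lev'' i = l"
      using 5(3) z0 assms(3) by (auto simp: l_def split: if_splits)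
    have z: "s' ''z'' 0 < n" using same assms by simp
    show ?case
    proof (rule run_mono[OF run_check_arc[OF Pre z]], goal_cases)
      case (1 s'')
      show ?case
      proof (cases "s ''lev'' i = l \<and> arc (s ''f'') z i")
        case True
        then have "s'' ''lev'' = (s' ''lev'')(z := Suc l) \<and> s'' ''nxt'' = (s' ''nxt'')(z := i) \<and> s'' ''ch'' 0 = 1"
          using 1 lev_i 5(2) same by (simp add: z_def l_def)
        moreover have "\<exists>y<Suc i. s ''lev'' y = l \<and> arc (s ''f'') z y" using True by blast
        moreover have "(s' ''lev'')(z := Suc l) = (s ''lev'')(z := Suc l) \<and>
            (s' ''nxt'')(z := i) = (s ''nxt'')(z := i)"
          using 5(3) by (auto split: if_splits)
        ultimately show ?thesis using True by auto
      next
        case False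
        then have "s'' ''lev'' = s' ''lev'' \<and> s'' ''nxt'' = s' ''nxt'' \<and> s'' ''ch'' 0 = s' ''ch'' 0"
          using 1 lev_i 5(2) same by (simp add: z_def l_def split: if_splits)
        moreover have "(y < Suc i \<and> s ''lev'' y = l \<and> arc (s ''f'') z y) \<longleftrightarrow>
            (y < i \<and> s ''lev'' y = l \<and> arc (s ''f'') z y)" for y
          using False less_Suc_eq by auto
        then have "(\<exists>y<Suc i. s ''lev'' y = l \<and> arc (s ''f'') z y) \<longleftrightarrow>
            (\<exists>y<i. s ''lev'' y = l \<and> arc (s ''f'') z y)"
          by simp
        ultimately show ?thesis using 5(3) by (auto simp: less_Suc_eq split: if_splits)
      qed
    qed
  next
    case (6 s')
    then show ?case using z0 by auto
  qed (use assms Pre_n N_ge in \<open>auto simp: check_arc_def build_set_def scratch_names_def\<close>)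
next
  case 2
  then show ?case by (intro run_intros) (auto simp: z_def)
qed

end

text \<open>One round of the search, interrupted after the positions below \<open>Z\<close>. Targets
  are judged by the labels from the start of the round, which is harmless since labels given during
  the round equal \<open>Suc l\<close> and never \<open>l\<close>.\<close>

definition (in loopless_nat_matroid) scanned ::
  "(nat \<Rightarrow> nat) \<Rightarrow> nat \<Rightarrow> nat \<Rightarrow> (nat \<Rightarrow> nat) \<Rightarrow> (nat \<Rightarrow> nat) \<Rightarrow> nat \<Rightarrow>
   (nat \<Rightarrow> nat) \<Rightarrow> (nat \<Rightarrow> nat) \<Rightarrow> nat \<Rightarrow> bool" where
  "scanned f k l lev nxt Z lev' nxt' ch' \<longleftrightarrow>
     (\<forall>w. Z \<le> w \<or> lev w \<noteq> 0 \<longrightarrow> lev' w = lev w \<and> nxt' w = nxt w) \<and>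
     (\<forall>w<Z. lev w = 0 \<longrightarrow>
        lev' w = Suc l \<and> nxt' w < n + k \<and> arc f w (nxt' w) \<and> lev (nxt' w) = l \<or>
        lev' w = 0 \<and> (\<forall>y<n + k. arc f w y \<longrightarrow> lev y \<noteq> l)) \<and>
     ch' = (if \<exists>w<Z. lev w = 0 \<and> lev' w \<noteq> 0 then 1 else 0)"

text \<open>Invariant of the search before level \<open>l\<close> is expanded. The sum in the last
  conjunct starts as 1 + n + 1, and each round raises \<open>l\<close> by one while the other two
  summands together drop by at least one; hence \<open>l\<close> never exceeds n + 2. The conjunct
  with \<open>2 \<le> l\<close> ensures that the dummies, of level 1, are expanded before the flag
  is cleared.\<close>

definition (in loopless_nat_matroid) levels_upto ::
  "(nat \<Rightarrow> nat) \<Rightarrow> nat \<Rightarrow> nat \<Rightarrow> (nat \<Rightarrow> nat) \<Rightarrow> (nat \<Rightarrow> nat) \<Rightarrow> nat \<Rightarrow> bool" where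
  "levels_upto f k l lev nxt ch \<longleftrightarrow> 1 \<le> l \<and> ch \<le> 1 \<and> (ch = 0 \<longrightarrow> 2 \<le> l) \<and>
    (\<forall>i<k. lev (n + i) = 1) \<and> (\<forall>z<n. lev z \<le> l) \<and>
    (\<forall>z<n. lev z > 0 \<longrightarrow> nxt z < n + k \<and> arc f z (nxt z) \<and> lev (nxt z) > 0 \<and>
       lev z = Suc (lev (nxt z))) \<and>
    (\<forall>z<n. \<forall>y<n + k. arc f z y \<longrightarrow> lev y > 0 \<longrightarrow> lev y < l \<longrightarrow> lev z > 0 \<and> lev z \<le> Suc (lev y)) \<and>
    (ch = 0 \<longrightarrow> (\<forall>z<n. lev z < l)) \<and> l + card {z. z < n \<and> lev z = 0} + ch \<le> n + 2"

context loopless_nat_matroid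
begin

lemma scanned_Suc:
  assumes sc: "scanned f k l lev nxt Z lev1 nxt1 ch1" and l: "1 \<le> l" and "Z < n"
    and step: "if lev1 Z = 0 \<and> (\<exists>y<n + k. lev1 y = l \<and> arc f Z y)
      then lev2 = lev1(Z := Suc l) \<and> ch2 = 1 \<and>
        (\<exists>y<n + k. lev1 y = l \<and> arc f Z y \<and> nxt2 = nxt1(Z := y))
      else lev2 = lev1 \<and> nxt2 = nxt1 \<and> ch2 = ch1"
  shows "scanned f k l lev nxt (Suc Z) lev2 nxt2 ch2"
proof -
  have old: "lev1 w = lev w \<and> nxt1 w = nxt w" if "Z \<le> w \<or> lev w \<noteq> 0" for w
    using sc that unfolding scanned_def by blast
  have new: "lev1 w = Suc l \<and> nxt1 w < n + k \<and> arc f w (nxt1 w) \<and> lev (nxt1 w) = l \<or>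
      lev1 w = 0 \<and> (\<forall>y<n + k. arc f w y \<longrightarrow> lev y \<noteq> l)" if "w < Z" "lev w = 0" for w
    using sc that unfolding scanned_def by blast
  have eq: "lev1 y = l \<longleftrightarrow> lev y = l" for y
    using old[of y] new[of y] l by (cases "Z \<le> y \<or> lev y \<noteq> 0") auto
  have Z: "lev1 Z = lev Z" "nxt1 Z = nxt Z" using old[of Z] by auto
  show ?thesis
  proof (cases "lev Z = 0 \<and> (\<exists>y<n + k. lev y = l \<and> arc f Z y)")
    case True
    then obtain y where y: "y < n + k" "lev y = l" "arc f Z y" "nxt2 = nxt1(Z := y)"
      and 2: "lev2 = lev1(Z := Suc l)" "ch2 = 1"
      using step unfolding eq Z by auto
    have "\<exists>w<Suc Z. lev w = 0 \<and> lev2 w \<noteq> 0" using True 2 by auto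
    moreover have "lev2 w = Suc l \<and> nxt2 w < n + k \<and> arc f w (nxt2 w) \<and> lev (nxt2 w) = l \<or>
        lev2 w = 0 \<and> (\<forall>y<n + k. arc f w y \<longrightarrow> lev y \<noteq> l)" if "w < Suc Z" "lev w = 0" for w
      using that new[of w] y 2 by (cases "w = Z") (auto simp: less_Suc_eq)
    moreover have "lev2 w = lev w \<and> nxt2 w = nxt w" if "Suc Z \<le> w \<or> lev w \<noteq> 0" for w
    proof -
      have "w \<noteq> Z" "Z \<le> w \<or> lev w \<noteq> 0" using that True by auto
      then show ?thesis using old[of w] y 2 by simp
    qed
    ultimately show ?thesis unfolding scanned_def using 2 by simp
  next
    case False
    then have 2: "lev2 = lev1" "nxt2 = nxt1" "ch2 = ch1" using step unfolding eq Z by (auto split: if_splits)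
    have "(\<exists>w<Suc Z. lev w = 0 \<and> lev2 w \<noteq> 0) \<longleftrightarrow> (\<exists>w<Z. lev w = 0 \<and> lev2 w \<noteq> 0)"
      using Z 2 by (auto simp: less_Suc_eq)
    moreover have "lev2 w = Suc l \<and> nxt2 w < n + k \<and> arc f w (nxt2 w) \<and> lev (nxt2 w) = l \<or>
        lev2 w = 0 \<and> (\<forall>y<n + k. arc f w y \<longrightarrow> lev y \<noteq> l)" if "w < Suc Z" "lev w = 0" for w
      using that new[of w] False Z 2 by (cases "w = Z") (auto simp: less_Suc_eq)
    moreover have "ch1 = (if \<exists>w<Z. lev w = 0 \<and> lev1 w \<noteq> 0 then 1 else 0)"
      using sc unfolding scanned_def by blast
    ultimately show ?thesis using old unfolding scanned_def 2 by simp
  qed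
qed

text \<open>An arc into a level below \<open>l\<close> was treated in an earlier round, one into
  level \<open>l\<close> in the round just made. The second claim is the decrease of the loop
  measure, whose old flag value is 1.\<close>

lemma levels_upto_Suc:
  assumes L: "levels_upto f k l lev nxt 1" and sc: "scanned f k l lev nxt n lev' nxt' ch'"
  shows "levels_upto f k (Suc l) lev' nxt' ch'"
    and "ch' + card {z. z < n \<and> lev' z = 0} < 1 + card {z. z < n \<and> lev z = 0}"
proof -
  have old: "lev' w = lev w" "nxt' w = nxt w" if "n \<le> w \<or> lev w \<noteq> 0" for w
    using sc that unfolding scanned_def by blast+
  have new: "lev' w = Suc l \<and> nxt' w < n + k \<and> arc f w (nxt' w) \<and> lev (nxt' w) = l \<or>
      lev' w = 0 \<and> (\<forall>y<n + k. arc f w y \<longrightarrow> lev y \<noteq> l)" if "w < n" "lev w = 0" for w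
    using sc that unfolding scanned_def by blast+
  have ch: "ch' = (if \<exists>w<n. lev w = 0 \<and> lev' w \<noteq> 0 then 1 else 0)"
    using sc unfolding scanned_def by blast
  have l: "1 \<le> l" and dummy: "\<And>i. i < k \<Longrightarrow> lev (n + i) = 1" and le: "\<And>z. z < n \<Longrightarrow> lev z \<le> l"
    and P1: "\<And>z. z < n \<Longrightarrow> lev z > 0 \<Longrightarrow> nxt z < n + k \<and> arc f z (nxt z) \<and> lev (nxt z) > 0 \<and>
       lev z = Suc (lev (nxt z))"
    and P2: "\<And>z y. z < n \<Longrightarrow> y < n + k \<Longrightarrow> arc f z y \<Longrightarrow> lev y > 0 \<Longrightarrow> lev y < l \<Longrightarrow>
       lev z > 0 \<and> lev z \<le> Suc (lev y)"
    and B: "l + card {z. z < n \<and> lev z = 0} + 1 \<le> n + 2"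
    using L unfolding levels_upto_def by blast+
  have le_k: "lev y \<le> l" if "y < n + k" for y
  proof (cases "y < n")
    case False
    define i where "i = y - n"
    have "y = n + i" "i < k" using False that by (auto simp: i_def)
    then show ?thesis using dummy[of i] l by simp
  qed (use le in simp)
  have sub: "{z. z < n \<and> lev' z = 0} \<subseteq> {z. z < n \<and> lev z = 0}" using old(1) by fastforce
  \<comment> \<open>Either nothing was labelled and the flag is 0, or the flag is 1 and at least one
    element left the unlabelled set.\<close>
  have card: "card {z. z < n \<and> lev' z = 0} + ch' \<le> card {z. z < n \<and> lev z = 0}"
  proof (cases "ch' = 0")
    case True
    then show ?thesis using card_mono[OF _ sub] by simp
  next
    case False
    then have "\<exists>w<n. lev w = 0 \<and> lev' w \<noteq> 0" unfolding ch by presburger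
    then obtain w where w: "w < n" "lev w = 0" "lev' w \<noteq> 0" by blast
    then have c1: "ch' = 1" unfolding ch by auto
    have "w \<in> {z. z < n \<and> lev z = 0}" "w \<notin> {z. z < n \<and> lev' z = 0}" using w by simp_all
    then have "{z. z < n \<and> lev' z = 0} \<subset> {z. z < n \<and> lev z = 0}" using sub by blast
    then have "card {z. z < n \<and> lev' z = 0} < card {z. z < n \<and> lev z = 0}"
      by (intro psubset_card_mono) auto
    then show ?thesis using c1 by simp
  qed
  then show "ch' + card {z. z < n \<and> lev' z = 0} < 1 + card {z. z < n \<and> lev z = 0}" by simp
  have 1: "lev' (n + i) = 1" if "i < k" for i using old(1)[of "n + i"] dummy[OF that] by simp
  have 2: "lev' z \<le> Suc l" if "z < n" for z
    using old(1)[of z] new[of z] le[of z] that by (cases "lev z = 0") auto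
  have 3: "nxt' z < n + k \<and> arc f z (nxt' z) \<and> lev' (nxt' z) > 0 \<and> lev' z = Suc (lev' (nxt' z))"
    if "z < n" "lev' z > 0" for z
  proof (cases "lev z = 0")
    case True
    then have z: "lev' z = Suc l" "nxt' z < n + k" "arc f z (nxt' z)" "lev (nxt' z) = l"
      using new[OF that(1)] that(2) by auto
    then show ?thesis using old(1)[of "nxt' z"] l by simp
  next
    case False
    then show ?thesis using P1[of z] that old[of z] old(1)[of "nxt z"] by simp
  qed
  have 4: "lev' z > 0 \<and> lev' z \<le> Suc (lev' y)"
    if z: "z < n" and y: "y < n + k" and arc: "arc f z y" and pos: "lev' y > 0" and lt: "lev' y < Suc l" for z y
  proof -
    have y0: "lev y \<noteq> 0" using new[of y] old(1)[of y] pos lt by (cases "y < n") auto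
    then have eq: "lev' y = lev y" using old by simp
    show ?thesis
    proof (cases "lev y = l")
      case True
      then show ?thesis using new[of z] old(1)[of z] le[of z] z y arc eq by (cases "lev z = 0") auto
    next
      case False
      then have "lev y < l" using lt eq by simp
      then show ?thesis using P2[OF z y arc] y0 old(1)[of z] eq by auto
    qed
  qed
  have 5: "lev' z < Suc l" if "ch' = 0" "z < n" for z
  proof (cases "lev z = 0")
    case True
    then have "lev' z = 0" using that unfolding ch by presburger
    then show ?thesis by simp
  qed (use that old(1)[of z] le[of z] in simp)
  have 6: "ch' \<le> 1" using ch by simp
  show "levels_upto f k (Suc l) lev' nxt' ch'"
    unfolding levels_upto_def using 1 2 3 4 5 6 l B card by auto
qed

text \<open>With the flag at 0 no label reaches \<open>l\<close>, so every labelled position has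
  been expanded and the side condition \<open>lev y < l\<close> holds throughout.\<close>

lemma levels_upto_final:
  assumes "levels_upto f k l lev nxt 0"
  shows "levels f k lev nxt"
proof -
  have lt: "lev y < l" if y: "y < n + k" for y
  proof (cases "y < n")
    case False
    define i where "i = y - n"
    have "y = n + i" "i < k" using False y by (auto simp: i_def)
    then show ?thesis using assms by (simp add: levels_upto_def)
  qed (use assms in \<open>simp add: levels_upto_def\<close>)
  have "l \<le> n + 2" using assms by (simp add: levels_upto_def)
  then have "\<forall>z<n. lev z \<le> n + 2" using lt by (meson less_imp_le le_trans trans_less_add1)
  then show ?thesis using assms lt unfolding levels_upto_def levels_def by blast
qed

end

section \<open>Correctness of the search and of the insertions\<close>

context partition_program
begin

lemma run_next_level:
  assumes "Pre s" "s ''l'' 0 \<ge> 1" "s ''k'' 0 \<le> n"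
  shows "run N orc (next_level T) s (\<lambda>s'. s' ''l'' 0 = Suc (s ''l'' 0) \<and>
    scanned (s ''f'') (s ''k'' 0) (s ''l'' 0) (s ''lev'') (s ''nxt'') n (s' ''lev'') (s' ''nxt'') (s' ''ch'' 0))"
  unfolding next_level_def
proof (rule run_Seq, rule run_Assign, rule run_Seq, rule run_For[where K = n and
      P = "\<lambda>Z s'. scanned (s ''f'') (s ''k'' 0) (s ''l'' 0) (s ''lev'') (s ''nxt'') Z
        (s' ''lev'') (s' ''nxt'') (s' ''ch'' 0)"], goal_cases)
  case (1 s')
  show ?case using Pre_n[OF assms(1)]
    by (simp add: 1 scan_element_def check_arc_def build_set_def scratch_names_def)
next
  case (5 Z s')
  have same: "s' ''f'' = s ''f''" "s' ''l'' = s ''l''" "s' ''k'' = s ''k''"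
    by (simp_all add: 5(4) scan_element_def check_arc_def build_set_def scratch_names_def)
  have Pre: "Pre s'"
  proof (rule Pre_cong[OF assms(1)])
    fix x assume "x \<in> input_names"
    moreover from this have "x \<noteq> ''ch''" by (auto simp: input_names_def)
    ultimately show "s' x = s x"
      by (subst 5(4)) (auto simp: input_names_def scan_element_def check_arc_def build_set_def)
  qed
  show ?case
  proof (rule run_mono[OF run_scan_element[OF Pre]], goal_cases)
    case (4 s'')
    from scanned_Suc[OF 5(3) assms(2) 5(1) 4[unfolded same 5(2)]] show ?case by simp
  qed (use 5(1,2) assms same in simp_all)
next
  case (6 s')
  have "s' ''l'' = s ''l''"
    by (simp add: 6(2) scan_element_def check_arc_def build_set_def scratch_names_def)
  then show ?case by (intro run_Assign) (simp add: 6)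
qed (use N_ge in \<open>auto simp: scanned_def scan_element_def check_arc_def build_set_def scratch_names_def\<close>)

lemma run_compute_levels:
  assumes "Pre s" "s ''k'' 0 \<le> n"
  shows "run N orc (compute_levels T) s
    (\<lambda>s'. levels (s ''f'') (s ''k'' 0) (s' ''lev'') (s' ''nxt''))"
  unfolding compute_levels_def
proof (rule run_Seq, rule run_For[where K = n and P = "\<lambda>i s'. \<forall>w<i. s' ''lev'' w = 0"], goal_cases)
  case (5 i s')
  then show ?case by (intro run_Assign) (auto simp: less_Suc_eq)
next
  case (6 s1)
  have N1: "s1 ''N'' 0 = n" "s1 ''k'' = s ''k''" using Pre_n[OF assms(1)] by (simp_all add: 6(2))
  show ?case
  proof (rule run_Seq, rule run_For[where K = "s ''k'' 0" and
        P = "\<lambda>i s'. (\<forall>w<n. s' ''lev'' w = 0) \<and> (\<forall>w<i. s' ''lev'' (n + w) = 1)"], goal_cases)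
    case (5 i s')
    have "s' ''N'' 0 = n" using N1 by (simp add: 5(4))
    then show ?case using 5(2,3) by (intro run_Assign) (auto simp: less_Suc_eq)
  next
    case (6 s2)
    have s2: "s2 x = s x" if "x \<noteq> ''q''" "x \<noteq> ''z''" "x \<noteq> ''lev''" for x
      using that by (simp add: 6(2) \<open>\<And>y. y \<noteq> ''z'' \<Longrightarrow> y \<notin> modified _ \<Longrightarrow> s1 y = s y\<close>)
    let ?I = "\<lambda>s'. levels_upto (s ''f'') (s ''k'' 0) (s' ''l'' 0) (s' ''lev'') (s' ''nxt'') (s' ''ch'' 0) \<and>
      Pre s' \<and> s' ''f'' = s ''f'' \<and> s' ''k'' = s ''k''"
    let ?m = "\<lambda>s'. s' ''ch'' 0 + card {z. z < n \<and> s' ''lev'' z = 0}"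
    show ?case
    proof (rule run_Seq, rule run_Assign, rule run_Seq, rule run_Assign,
        rule run_mono[OF run_While[where I = ?I and m = ?m]], goal_cases)
      case (1 s')
      then have I: "?I s'" and ch: "s' ''ch'' 0 = 1" by auto
      show ?case
      proof (rule run_frame[OF run_next_level], goal_cases)
        case (4 s'')
        have "Pre s''"
          by (rule Pre_cong[of s'], use I in blast, rule 4(2))
            (auto simp: input_names_def next_level_def scan_element_def check_arc_def build_set_def)
        moreover have "s'' ''f'' = s' ''f''" "s'' ''k'' = s' ''k''"
          by (simp_all add: 4(2) next_level_def scan_element_def check_arc_def build_set_def scratch_names_def)
        ultimately show ?case
          using levels_upto_Suc[of "s ''f''" "s ''k'' 0" "s' ''l'' 0" "s' ''lev''" "s' ''nxt''"
              "s'' ''lev''" "s'' ''nxt''" "s'' ''ch'' 0"] I ch 4(1) by simp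
      qed (use I assms in \<open>simp_all add: levels_upto_def\<close>)
    next
      case 2
      have "Pre (s2(''l'' := (s2 ''l'')(0 := 1), ''ch'' := (s2 ''ch'')(0 := 1)))"
        by (rule Pre_cong[OF assms(1)]) (auto simp: input_names_def s2)
      moreover have "{z. z < n \<and> s2 ''lev'' z = 0} = {..<n}" using 6(1) by auto
      ultimately show ?case using 6(1) by (simp add: levels_upto_def s2)
    next
      case 3
      have "{z. z < n \<and> s2 ''lev'' z = 0} = {..<n}" using 6(1) by auto
      then show ?case using N_ge by simp
    next
      case (4 s')
      then have "s' ''ch'' 0 = 0" by (auto simp: levels_upto_def)
      then show ?case using 4 levels_upto_final by auto
    qed
  qed (use 6 N1 assms N_ge in auto)
qed (use Pre_n[OF assms(1)] N_ge in auto)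

text \<open>State while element \<open>j\<close> is being inserted: the uncolored position
  \<open>x\<close> is at most \<open>j\<close>, or has left the elements through a dummy. Elements
  beyond \<open>j\<close> have color 0, so no arc enters them and \<open>x\<close> never moves past
  \<open>j\<close>.\<close>

definition inserting :: "nat \<Rightarrow> nat \<Rightarrow> store \<Rightarrow> bool" where
  "inserting j k s \<longleftrightarrow> Pre s \<and> s ''k'' 0 = k \<and> partial_coloring (s ''f'') k \<and> lower_bound k \<and>
    (s ''x'' 0 < n \<longrightarrow> s ''x'' 0 \<le> j \<and> s ''f'' (s ''x'' 0) = 0) \<and>
    (\<forall>z\<le>j. z \<noteq> s ''x'' 0 \<longrightarrow> s ''f'' z \<noteq> 0) \<and> (\<forall>z<n. j < z \<longrightarrow> s ''f'' z = 0)"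

definition colored_upto :: "nat \<Rightarrow> store \<Rightarrow> bool" where
  "colored_upto j s \<longleftrightarrow> Pre s \<and> partial_coloring (s ''f'') (s ''k'' 0) \<and> lower_bound (s ''k'' 0) \<and>
    (\<forall>z<j. s ''f'' z \<noteq> 0) \<and> (\<forall>z<n. j \<le> z \<longrightarrow> s ''f'' z = 0)"

lemma Pre_compute_levels:
  assumes "Pre s" "\<And>x. x \<notin> modified (compute_levels T) \<Longrightarrow> s' x = s x"
  shows "Pre s'"
  by (rule Pre_cong[OF assms(1)], rule assms(2))
    (auto simp: input_names_def compute_levels_def next_level_def scan_element_def check_arc_def
      build_set_def)

lemma compute_levels_unmodified:
  assumes "\<And>x. x \<notin> modified (compute_levels T) \<Longrightarrow> s' x = s x"
  shows "s' ''f'' = s ''f''" "s' ''k'' = s ''k''" "s' ''x'' = s ''x''"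
  by (simp_all add: assms compute_levels_def next_level_def scan_element_def check_arc_def
      build_set_def scratch_names_def)

lemma run_shift_coloring:
  assumes I: "inserting j k s" and lev: "levels (s ''f'') k (s ''lev'') (s ''nxt'')"
    and x: "s ''x'' 0 < n" "0 < s ''lev'' (s ''x'' 0)"
  shows "run N orc (shift_coloring T) s (\<lambda>s'. (inserting j k s' \<and>
    levels (s' ''f'') k (s' ''lev'') (s' ''nxt'')) \<and> s' ''lev'' (s' ''x'' 0) < s ''lev'' (s ''x'' 0))"
proof -
  define x where "x = s ''x'' 0"
  define y where "y = s ''nxt'' x"
  define f where "f = s ''f''"
  define f' where "f' = recolor f x y"
  have Pre: "Pre s" and k: "s ''k'' 0 = k" and f: "partial_coloring f k" and lb: "lower_bound k"
    and xj: "x \<le> j" "f x = 0" and colored: "\<And>z. z \<le> j \<Longrightarrow> z \<noteq> x \<Longrightarrow> f z \<noteq> 0"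
    and todo: "\<And>z. z < n \<Longrightarrow> j < z \<Longrightarrow> f z = 0"
    using I x(1) by (auto simp: inserting_def f_def x_def)
  have y: "y < n + k" "arc f x y"
    using lev x unfolding levels_def y_def x_def f_def by auto
  have fy: "f y \<noteq> 0" "x \<noteq> y" using y(2) by (auto simp: arc_def)
  have f': "partial_coloring f' k"
    unfolding f'_def using recolor_partial_coloring[OF f _ xj(2) y] x(1) by (simp add: x_def)
  define s1 where "s1 = s(''q'' := (s ''q'')(0 := y), ''f'' := f', ''x'' := (s ''x'')(0 := y))"
  have "Pre s1" by (rule Pre_cong[OF Pre]) (auto simp: s1_def input_names_def)
  then have s1: "Pre s1" "s1 ''k'' = s ''k''" "s1 ''f'' = f'" "s1 ''x'' 0 = y"
    by (simp_all add: s1_def)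
  have kn: "k \<le> n" using lower_bound_le[OF lb] .
  have "run N orc (compute_levels T) s1 (\<lambda>s'. (inserting j k s' \<and>
    levels (s' ''f'') k (s' ''lev'') (s' ''nxt'')) \<and> s' ''lev'' (s' ''x'' 0) < s ''lev'' (s ''x'' 0))"
  proof (rule run_frame[OF run_compute_levels[OF s1(1)]])
    fix s' assume L: "levels (s1 ''f'') (s1 ''k'' 0) (s' ''lev'') (s' ''nxt'')"
      and fr: "\<And>x. x \<notin> modified (compute_levels T) \<Longrightarrow> s' x = s1 x"
    note same = compute_levels_unmodified[of s' s1, OF fr] Pre_compute_levels[OF s1(1) fr]
    have "s' ''lev'' y < s ''lev'' x"
      using recolor_levels[of f k x "s ''lev''" "s ''nxt''" "s' ''lev''" "s' ''nxt''"]
        f xj lev x L s1 k by (simp add: f_def x_def y_def f'_def)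
    moreover have "y \<le> j" if "y < n" using todo fy that by (meson not_le)
    moreover have "f' y = 0" if "y < n" using that by (simp add: f'_def recolor_def)
    moreover have "f' z \<noteq> 0" if "z \<le> j" "z \<noteq> y" for z
      using that colored fy by (simp add: f'_def recolor_def)
    moreover have "f' z = 0" if "z < n" "j < z" for z
      using that todo xj by (auto simp: f'_def recolor_def)
    ultimately show "(inserting j k s' \<and> levels (s' ''f'') k (s' ''lev'') (s' ''nxt'')) \<and>
        s' ''lev'' (s' ''x'' 0) < s ''lev'' (s ''x'' 0)"
      using L same s1 k f' lb by (simp add: inserting_def x_def)
  qed (use s1 k kn in simp)
  moreover have N0: "s ''N'' 0 = n" using Pre_n[OF Pre] .
  moreover have "s(''q'' := (s ''q'')(0 := y), ''f'' := f(x := f y), ''x'' := (s ''x'')(0 := y)) = s1"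
    if "\<not> y < n" using that by (simp add: s1_def f'_def recolor_def)
  moreover have "s(''q'' := (s ''q'')(0 := y), ''f'' := f(x := f y, y := 0), ''x'' := (s ''x'')(0 := y)) = s1"
    if "y < n" using that by (simp add: s1_def f'_def recolor_def)
  ultimately show ?thesis unfolding shift_coloring_def
    by (intro run_intros) (simp_all flip: x_def y_def f_def)
qed

lemma run_insert_element:
  assumes P: "colored_upto j s" and j: "s ''j'' 0 = j" "j < n"
  shows "run N orc (insert_element T) s (colored_upto (Suc j))"
  unfolding insert_element_def
proof (rule run_Seq, rule run_Assign, rule run_Seq, rule run_frame[OF run_compute_levels], goal_cases)
  let ?s = "s(''x'' := (s ''x'')(aval (Const 0) s := aval (Var ''j'') s))"
  have Pre: "Pre ?s" by (rule Pre_cong[of s]) (use P in \<open>auto simp: colored_upto_def input_names_def\<close>)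
  case 1
  show ?case by (fact Pre)
  case 2
  show ?case using P lower_bound_le by (auto simp: colored_upto_def)
  case (3 s1)
  define k where "k = s ''k'' 0"
  note same = compute_levels_unmodified[of s1 ?s, OF 3(2)] Pre_compute_levels[OF Pre 3(2)]
  let ?I = "\<lambda>s'. inserting j k s' \<and> levels (s' ''f'') k (s' ''lev'') (s' ''nxt'')"
  \<comment> \<open>The level of the uncolored position: at most n + 2 initially, and lowered by
    every exchange.\<close>
  let ?m = "\<lambda>s' :: store. s' ''lev'' (s' ''x'' 0)"
  have I1: "?I s1"
    using 3(1) same P j by (auto simp: inserting_def colored_upto_def k_def)
  show ?case
  proof (rule run_Seq, rule run_mono[OF run_While[where I = ?I and m = ?m]], goal_cases)
    case (1 s')
    then have "s' ''N'' 0 = n" using Pre_n by (auto simp: inserting_def)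
    then show ?case using 1 run_shift_coloring[of j k s'] by simp
  next
    case 2
    show ?case by (fact I1)
  next
    case 3
    have "s1 ''lev'' (s1 ''x'' 0) \<le> n + 2" using I1 same j by (simp add: levels_def)
    then show ?case using N_ge by simp
  next
    case (4 s')
    then have I: "inserting j k s'" and L: "levels (s' ''f'') k (s' ''lev'') (s' ''nxt'')" by auto
    define f x where "f = s' ''f''" and "x = s' ''x'' 0"
    have Pre: "Pre s'" and k: "s' ''k'' 0 = k" and f: "partial_coloring f k" and lb: "lower_bound k"
      and xj: "x < n \<Longrightarrow> x \<le> j \<and> f x = 0" and colored: "\<And>z. z \<le> j \<Longrightarrow> z \<noteq> x \<Longrightarrow> f z \<noteq> 0"
      and todo: "\<And>z. z < n \<Longrightarrow> j < z \<Longrightarrow> f z = 0"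
      using I by (auto simp: inserting_def f_def x_def)
    have n0: "s' ''N'' 0 = n" using Pre_n[OF Pre] .
    show ?case
    proof (rule run_If)
      assume "bval (Less (Var ''x'') (Var ''N'')) s'"
      then have xn: "x < n" using n0 by (simp add: x_def)
      have fx: "f x = 0" using xj[OF xn] by simp
      have "s' ''lev'' x = 0" using 4 n0 xn by (simp add: x_def)
      with unreachable_lower_bound[OF f xn fx L[folded f_def]] have lb': "lower_bound (Suc k)" .
      have f': "partial_coloring (f(n + k := Suc k, x := Suc k)) (Suc k)"
        by (rule new_color_partial_coloring[OF f xn fx])
      define s2 where "s2 = s'(''f'' := f(n + k := Suc k, x := Suc k), ''k'' := (s' ''k'')(0 := Suc k))"
      have "Pre s2" by (rule Pre_cong[OF Pre]) (auto simp: s2_def input_names_def)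
      then have "colored_upto (Suc j) s2"
        using lb' f' colored todo xj xn by (auto simp: colored_upto_def s2_def)
      then show "run N orc (Seq (Assign ''f'' (Plus (Var ''N'') (Var ''k'')) (Plus (Var ''k'') (Const 1)))
           (Seq (Assign ''k'' (Const 0) (Plus (Var ''k'') (Const 1)))
                (Assign ''f'' (Var ''x'') (Var ''k'')))) s' (colored_upto (Suc j))"
        by (intro run_intros) (simp add: n0 k s2_def fun_upd_twist flip: f_def x_def)
    next
      assume "\<not> bval (Less (Var ''x'') (Var ''N'')) s'"
      then have "\<not> x < n" using n0 by (simp add: x_def)
      have "\<forall>z<Suc j. f z \<noteq> 0"
      proof (intro allI impI)
        fix z assume "z < Suc j" then show "f z \<noteq> 0"
          using colored[of z] \<open>\<not> x < n\<close> j(2) by (cases "z = x") simp_all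
      qed
      moreover have "\<forall>z<n. Suc j \<le> z \<longrightarrow> f z = 0" using todo by simp
      ultimately have "colored_upto (Suc j) s'"
        using Pre f lb by (simp only: colored_upto_def k f_def simp_thms)
      with run_Skip[of "colored_upto (Suc j)"] show "run N orc Skip s' (colored_upto (Suc j))" .
    qed
  qed
qed

lemma partition_program_modified: "x \<in> {''j''} \<union> input_names \<Longrightarrow> x \<notin> modified (insert_element T)"
  by (auto simp: program_defs input_names_def scratch_names_def)

lemma run_partition:
  assumes "Pre s" "s ''k'' 0 = 0" "\<And>i. s ''f'' i = 0"
  shows "run N orc (partition T) s (\<lambda>s'. proper (s' ''f'') \<and>
    (\<forall>g :: nat \<Rightarrow> nat. proper g \<longrightarrow> card (s' ''f'' ` {..<n}) \<le> card (g ` {..<n})))"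
  unfolding partition_def
proof (rule run_For[where K = n and P = colored_upto], goal_cases)
  case (1 s')
  then show ?case using Pre_n[OF assms(1)] partition_program_modified[of "''N''"]
    by (simp add: input_names_def)
next
  case 4
  have "Pre (s(''j'' := (s ''j'')(0 := 0)))"
    by (rule Pre_cong[OF assms(1)]) (auto simp: input_names_def)
  then show ?case using assms by (simp add: colored_upto_def partial_coloring_def lower_bound_def)
next
  case (5 j s')
  have "colored_upto (Suc j) (s''(''j'' := (s'' ''j'')(0 := Suc j)))" if "colored_upto (Suc j) s''" for s''
  proof -
    have "Pre s''" using that by (simp add: colored_upto_def)
    then have "Pre (s''(''j'' := (s'' ''j'')(0 := Suc j)))"
      by (rule Pre_cong) (auto simp: input_names_def)
    then show ?thesis using that by (simp add: colored_upto_def)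
  qed
  then show ?case by (rule run_mono[OF run_insert_element[OF 5(3,2,1)]])
next
  case (6 s')
  then have "partial_coloring (s' ''f'') (s' ''k'' 0)" "lower_bound (s' ''k'' 0)"
    "\<And>z. z < n \<Longrightarrow> s' ''f'' z \<noteq> 0"
    by (auto simp: colored_upto_def)
  \<comment> \<open>\<open>proper_id\<close> supplies some proper \<open>g\<close>, under which the
    first conclusion is obtained.\<close>
  from proper_of_partial_coloring[OF this(1) _ this(2)] this(3) proper_id show ?case by blast
qed (use N_ge partition_program_modified[of "''j''"] in auto)

end

section \<open>Matroids given by an independence oracle\<close>

text \<open>\<open>B\<close> is a maximal independent subset of the complement of \<open>Y\<close>,
  and that complement contains a basis iff \<open>B\<close> is one. Elements outside
  \<open>Y\<close> cannot extend \<open>B\<close>, so only those of \<open>Y\<close> remain to be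
  tried.\<close>

lemma (in matroid) indep_dual_iff_greedy:
  assumes "B \<in> indep M" "B \<subseteq> ground M - Y" "Y \<subseteq> ground M"
    and max: "\<And>w. w \<in> ground M - Y - B \<Longrightarrow> insert w B \<notin> indep M"
  shows "Y \<in> indep (dual M) \<longleftrightarrow> (\<forall>w\<in>Y. insert w B \<notin> indep M)"
proof
  assume "Y \<in> indep (dual M)"
  then obtain B' where B': "basis M B'" "Y \<subseteq> ground M - B'" by (auto simp: dual_def)
  then have "B' \<in> indep M" by (simp add: basis_def)
  then have "\<not> card B < card B'"
    using indep_augment[OF assms(1), of B'] max B'(2) indep_subset by blast
  then have "card B = card B'" using basis_card_maximal[OF B'(1) assms(1)] by simp
  then have "basis M B" using basis_of_card[OF B'(1) assms(1)] by simp
  then show "\<forall>w\<in>Y. insert w B \<notin> indep M" using assms(2) unfolding basis_def by blast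
next
  assume *: "\<forall>w\<in>Y. insert w B \<notin> indep M"
  have "X = B" if X: "X \<in> indep M" "B \<subseteq> X" for X
  proof (rule ccontr)
    assume "X \<noteq> B"
    then obtain w where w: "w \<in> X - B" using X(2) by blast
    then have "insert w B \<in> indep M" using X indep_hereditary[of X "insert w B"] by blast
    moreover have "w \<in> ground M" using w X(1) indep_subset by blast
    ultimately show False using * max[of w] w by blast
  qed
  then have "basis M B" using assms(1) unfolding basis_def by blast
  then show "Y \<in> indep (dual M)" using assms(2,3) by (auto simp: dual_def)
qed

text \<open>Bases correspond to each other under the bijection given by the enumeration, and with
  them the subsets of their complements.\<close>

lemma indep_dual_index_matroid:
  assumes "matroid M" "enumerates es (ground M)" "X \<subseteq> {..<length es}"
  shows "X \<in> indep (dual (index_matroid M es)) \<longleftrightarrow> (!) es ` X \<in> indep (dual M)"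
proof -
  interpret matroid M by fact
  let ?K = "index_matroid M es"
  let ?inv = "\<lambda>Y. {i. i < length es \<and> es ! i \<in> Y}"
  have inj: "inj_on ((!) es) {..<length es}" and img: "(!) es ` {..<length es} = ground M"
    using assms(2) by (auto simp: enumerates_def set_conv_nth intro: inj_on_nth)
  have img_inv: "(!) es ` ?inv Y = Y" if "Y \<subseteq> ground M" for Y using that img by auto
  have inv_img: "?inv ((!) es ` Y) = Y" if "Y \<subseteq> {..<length es}" for Y
    using that inj by (auto dest: inj_onD)
  have basis_img: "basis M ((!) es ` B)" if B: "basis ?K B" for B
    unfolding basis_def
  proof (intro conjI ballI impI)
    show "(!) es ` B \<in> indep M" using B by (auto simp: basis_def index_matroid_def)
    fix Y assume Y: "Y \<in> indep M" "(!) es ` B \<subseteq> Y"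
    have YG: "Y \<subseteq> ground M" using indep_subset[OF Y(1)] .
    have "?inv Y \<in> indep ?K" using Y(1) img_inv[OF YG] by (auto simp: index_matroid_def)
    moreover have "B \<subseteq> ?inv Y" using B Y(2) by (auto simp: basis_def index_matroid_def)
    ultimately have "?inv Y = B" using B by (simp add: basis_def)
    then show "Y = (!) es ` B" using img_inv[OF YG] by simp
  qed
  have basis_inv: "basis ?K (?inv B)" if B: "basis M B" for B
    unfolding basis_def
  proof (intro conjI ballI impI)
    have BG: "B \<subseteq> ground M" and Bi: "B \<in> indep M" using B indep_subset by (auto simp: basis_def)
    then show "?inv B \<in> indep ?K" using img_inv[OF BG] by (auto simp: index_matroid_def)
    fix Y assume Y: "Y \<in> indep ?K" "?inv B \<subseteq> Y"
    have "B \<subseteq> (!) es ` Y" using image_mono[OF Y(2), of "(!) es"] img_inv[OF BG] by simp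
    moreover have "(!) es ` Y \<in> indep M" using Y(1) by (simp add: index_matroid_def)
    ultimately have "(!) es ` Y = B" using B by (simp add: basis_def)
    then show "Y = ?inv B" using inv_img[of Y] Y(1) by (auto simp: index_matroid_def)
  qed
  show ?thesis
  proof
    assume "X \<in> indep (dual ?K)"
    then obtain B where B: "basis ?K B" "X \<inter> B = {}" by (auto simp: dual_def)
    have "B \<subseteq> {..<length es}" using B(1) by (auto simp: basis_def index_matroid_def)
    then have "(!) es ` X \<inter> (!) es ` B = {}"
      using B(2) inj assms(3) by (metis inj_on_image_Int image_empty)
    moreover have "(!) es ` X \<subseteq> ground M" using assms(3) img by blast
    ultimately have "(!) es ` X \<subseteq> ground M - (!) es ` B" by blast
    then show "(!) es ` X \<in> indep (dual M)" using basis_img[OF B(1)] by (auto simp: dual_def)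
  next
    assume "(!) es ` X \<in> indep (dual M)"
    then obtain B where B: "basis M B" "(!) es ` X \<subseteq> ground M - B" by (auto simp: dual_def)
    then have "X \<subseteq> {..<length es} - ?inv B" using assms(3) by auto
    then show "X \<in> indep (dual ?K)" using basis_inv[OF B(1)] by (auto simp: dual_def index_matroid_def)
  qed
qed

lemma indep_oracle_iff: "indep_oracle M es S \<longleftrightarrow> {i. i < length es \<and> i \<in> S} \<in> indep (index_matroid M es)"
proof -
  have "{es ! i | i. i < length es \<and> i \<in> S} = (!) es ` {i. i < length es \<and> i \<in> S}" by auto
  then show ?thesis by (auto simp: indep_oracle_def index_matroid_def)
qed

text \<open>Greedy choice outside \<open>y\<close>, collected in \<open>tb\<close>, then each
  element of \<open>y\<close> tried on top of it. \<open>tc\<close> is 0 or 1, so copying it back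
  drops or keeps the element just tried. \<open>tb\<close> is cleared first because the test is run
  many times.\<close>

definition dual_indep_test :: com where
  "dual_indep_test =
     Seq (For ''ta'' (Var ''N'') (Assign ''tb'' (Var ''ta'') (Const 0)))
    (Seq (For ''ta'' (Var ''N'')
       (If (Equal (Cell ''y'' (Var ''ta'')) (Const 0))
         (Seq (Assign ''tb'' (Var ''ta'') (Const 1))
         (Seq (Query ''tc'' ''tb'')
              (Assign ''tb'' (Var ''ta'') (Var ''tc''))))
         Skip))
    (Seq (Assign ''r'' (Const 0) (Const 1))
         (For ''ta'' (Var ''N'')
       (If (Equal (Cell ''y'' (Var ''ta'')) (Const 0))
         Skip
         (Seq (Assign ''tb'' (Var ''ta'') (Const 1))
         (Seq (Query ''tc'' ''tb'')
         (Seq (If (Equal (Var ''tc'') (Const 1)) (Assign ''r'' (Const 0) (Const 0)) Skip)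
              (Assign ''tb'' (Var ''ta'') (Const 0)))))))))"

lemma run_dual_indep_test:
  fixes M :: "'a set_system"
  assumes "matroid M" "distinct es"
  defines "n \<equiv> length es" and "K \<equiv> index_matroid M es"
  assumes N: "n \<le> N" and s: "s ''N'' 0 = n"
  shows "run N (indep_oracle M es) dual_indep_test s
    (\<lambda>s'. s' ''r'' 0 = (if {i. i < n \<and> s ''y'' i \<noteq> 0} \<in> indep (dual K) then 1 else 0))"
proof -
  interpret K: matroid K unfolding K_def by (rule matroid_index_matroid) fact+
  have orc: "indep_oracle M es {i. p i} \<longleftrightarrow> {i. i < n \<and> p i} \<in> indep K" for p
    by (simp add: indep_oracle_iff n_def K_def)
  define Y where "Y = {i. i < n \<and> s ''y'' i \<noteq> 0}"
  define set_of where "set_of s' = {i. i < n \<and> s' ''tb'' i \<noteq> 0}" for s' :: store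
  \<comment> \<open>Rejections stay justified as the chosen set grows, since a superset of a
    dependent set is dependent.\<close>
  let ?greedy = "\<lambda>i s'. (\<forall>w<n. i \<le> w \<longrightarrow> s' ''tb'' w = 0) \<and> set_of s' \<inter> Y = {} \<and> set_of s' \<in> indep K \<and>
    (\<forall>w<i. w \<notin> Y \<longrightarrow> w \<notin> set_of s' \<longrightarrow> insert w (set_of s') \<notin> indep K)"
  show ?thesis unfolding dual_indep_test_def
  proof (rule run_Seq, rule run_For[where K = n and P = "\<lambda>i s'. \<forall>w<i. s' ''tb'' w = 0"], goal_cases)
    case (5 i s')
    then show ?case by (intro run_Assign) (auto simp: less_Suc_eq)
  next
    case (6 s1)
    have s1: "s1 ''N'' 0 = n" "s1 ''y'' = s ''y''" using s by (simp_all add: 6(2))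
    show ?case
    proof (rule run_Seq, rule run_For[where K = n and P = ?greedy], goal_cases)
      case 4
      have "set_of (s1(''ta'' := (s1 ''ta'')(0 := 0))) = {}" using 6(1) by (simp add: set_of_def)
      then show ?case using 6(1) K.indep_empty by simp
    next
      case (5 i s')
      have y: "s' ''y'' = s ''y''" using s1 by (simp add: 5(4))
      have i: "i \<notin> set_of s'" using 5(3) by (auto simp: set_of_def)
      have ins: "{w. w < n \<and> ((s' ''tb'')(i := 1)) w \<noteq> 0} = insert i (set_of s')"
        using 5(1) by (auto simp: set_of_def)
      show ?case
      proof (cases "i \<in> Y")
        case True
        then have "s' ''y'' i \<noteq> 0" using y by (simp add: Y_def)
        moreover have "?greedy (Suc i) (s'(''ta'' := (s' ''ta'')(0 := Suc i)))"
          using 5(3) True by (auto simp: set_of_def less_Suc_eq)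
        ultimately show ?thesis using 5(2) by (intro run_intros) simp_all
      next
        case False
        then have y0: "s' ''y'' i = 0" using y 5(1) by (simp add: Y_def)
        define v where "v = (if insert i (set_of s') \<in> indep K then 1 else 0 :: nat)"
        define s2 where "s2 = s'(''tb'' := (s' ''tb'')(i := v), ''tc'' := (s' ''tc'')(0 := v),
          ''ta'' := (s' ''ta'')(0 := Suc i))"
        have set: "set_of s2 = (if v = 1 then insert i (set_of s') else set_of s')"
          using 5(1) i by (auto simp: set_of_def s2_def v_def)
        have "?greedy (Suc i) s2"
        proof (intro conjI allI impI)
          show "s2 ''tb'' w = 0" if "w < n" "Suc i \<le> w" for w using 5(3) that by (simp add: s2_def)
          show "set_of s2 \<inter> Y = {}" using 5(3) False unfolding set by auto
          show "set_of s2 \<in> indep K" using 5(3) unfolding set by (simp add: v_def)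
          fix w assume w: "w < Suc i" "w \<notin> Y" "w \<notin> set_of s2"
          show "insert w (set_of s2) \<notin> indep K"
          proof (cases "w = i")
            case True
            then show ?thesis using w(3) unfolding set by (auto simp: v_def split: if_splits)
          next
            case False
            then have "insert w (set_of s') \<notin> indep K"
              using w 5(3) unfolding set by (auto split: if_splits)
            moreover have "insert w (set_of s') \<subseteq> insert w (set_of s2)" unfolding set by auto
            ultimately show ?thesis using K.indep_hereditary by blast
          qed
        qed
        then show ?thesis using 5(2) y0
          by (intro run_intros) (simp_all add: orc ins[simplified] s2_def v_def fun_upd_twist)
      qed
    next
      case (6 s2)
      have s2: "s2 ''N'' 0 = n" "s2 ''y'' = s ''y''" using s1 by (simp_all add: 6(2))
      define B where "B = set_of s2"
      have Y_eq: "Y \<in> indep (dual K) \<longleftrightarrow> (\<forall>w\<in>Y. insert w B \<notin> indep K)"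
        by (rule K.indep_dual_iff_greedy)
          (use 6(1) in \<open>auto simp: B_def K_def index_matroid_def n_def[symmetric] Y_def set_of_def\<close>)
      show ?case
      proof (rule run_Seq, rule run_Assign, rule run_For[where K = n and P = "\<lambda>i s'. set_of s' = B \<and>
          s' ''r'' 0 = (if \<exists>w\<in>Y. w < i \<and> insert w B \<in> indep K then 0 else 1)"], goal_cases)
        case 4
        then show ?case by (simp add: B_def set_of_def)
      next
        case (5 i s')
        have y: "s' ''y'' = s ''y''" using s2 by (simp add: 5(4))
        show ?case
        proof (cases "i \<in> Y")
          case False
          then have "s' ''y'' i = 0" using y 5(1) by (simp add: Y_def)
          moreover have "(\<exists>w\<in>Y. w < Suc i \<and> insert w B \<in> indep K) \<longleftrightarrow> (\<exists>w\<in>Y. w < i \<and> insert w B \<in> indep K)"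
            using False less_Suc_eq by auto
          ultimately show ?thesis using 5(2,3) by (intro run_intros) (simp_all add: set_of_def)
        next
          case True
          then have y1: "s' ''y'' i \<noteq> 0" using y by (simp add: Y_def)
          have "i \<notin> B" using 6(1) True by (auto simp: B_def)
          then have tb: "s' ''tb'' i = 0" using 5(1,3) by (auto simp: set_of_def)
          have ins: "{w. w < n \<and> 0 < (if w = i then Suc 0 else s' ''tb'' w)} = insert i B"
            using 5(1,3) by (auto simp: set_of_def)
          have ex: "(\<exists>w\<in>Y. w < Suc i \<and> insert w B \<in> indep K) \<longleftrightarrow>
              insert i B \<in> indep K \<or> (\<exists>w\<in>Y. w < i \<and> insert w B \<in> indep K)"
            using True less_Suc_eq by auto
          \<comment> \<open>The form in which simplification leaves the marked set once cell
            \<open>i\<close> of \<open>tb\<close> has been reset to 0.\<close>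
          have set: "{w. w \<noteq> i \<and> (w \<noteq> i \<longrightarrow> w < n \<and> 0 < s' ''tb'' w)} = B"
            using 5(3) tb by (auto simp: set_of_def)
          show ?thesis
          proof (cases "insert i B \<in> indep K")
            case True
            then show ?thesis using 5(2,3) y1
              by (intro run_intros) (simp_all add: orc ins ex set set_of_def)
          next
            case False
            then show ?thesis using 5(2,3) y1
              by (intro run_intros) (simp_all add: orc ins ex set set_of_def)
          qed
        qed
      next
        case (6 s')
        have "(\<exists>w\<in>Y. w < n \<and> insert w B \<in> indep K) \<longleftrightarrow> (\<exists>w\<in>Y. insert w B \<in> indep K)"
          by (auto simp: Y_def)
        then have "s' ''r'' 0 = (if Y \<in> indep (dual K) then 1 else 0)"
          using 6(1) unfolding Y_eq by simp
        then show ?case unfolding Y_def .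
      qed (use s2 N in auto)
    qed (use s1 N in auto)
  qed (use s N in auto)
qed

section \<open>Minimum 1-courteous colorings\<close>

definition courteous_coloring_program :: com where
  "courteous_coloring_program = Seq (Assign ''N'' (Const 0) (Var ''n'')) (partition dual_indep_test)"

lemma courteous_coloring_program_correct:
  fixes M :: "'a set_system"
  assumes "matroid M" "bridgeless M" "enumerates es (ground M)"
  shows "\<exists>t s f. exec (indep_oracle M es) courteous_coloring_program (matroid_input es) t s \<and>
    t \<le> cost_bound (2 * card (ground M) + 3) courteous_coloring_program \<and>
    output_coloring es s f \<and> min_courteous1 M f"
proof -
  interpret M: matroid M by fact
  define n where "n = length es"
  define K where "K = dual (index_matroid M es)"
  have es: "distinct es" "set es = ground M" using assms(3) by (auto simp: enumerates_def)
  have card: "card (ground M) = n" using es distinct_card[of es] by (simp add: n_def)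
  interpret K: matroid K
    unfolding K_def by (rule matroid.matroid_dual, rule matroid_index_matroid) (fact assms(1), fact es)
  have gK: "ground K = {..<n}" by (simp add: K_def dual_def index_matroid_def n_def)
  have indep_K: "X \<in> indep K \<longleftrightarrow> (!) es ` X \<in> indep (dual M)" if "X \<subseteq> {..<n}" for X
    using indep_dual_index_matroid[OF assms(1,3)] that by (simp add: K_def n_def)
  interpret P: partition_program K n "2 * n + 3" "indep_oracle M es" dual_indep_test
    "\<lambda>s. s ''N'' 0 = n"
  proof
    fix i assume "i < n"
    moreover from this have "es ! i \<in> ground M" using es(2) nth_mem[of i es] by (simp add: n_def)
    ultimately show "{i} \<in> indep K"
      using indep_K[of "{i}"] M.indep_dual_singleton[OF assms(2)] by simp
  next
    fix s :: store assume "s ''N'' 0 = n"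
    then show "run (2 * n + 3) (indep_oracle M es) dual_indep_test s
      (\<lambda>s'. s' ''r'' 0 = (if {i. i < n \<and> s ''y'' i \<noteq> 0} \<in> indep K then 1 else 0))"
      unfolding K_def n_def by (intro run_dual_indep_test) (use assms(1) es in auto)
  qed (use gK in \<open>auto simp: dual_indep_test_def scratch_names_def input_names_def\<close>)
  have classes: "{e \<in> ground M. g e = c} = (!) es ` {w. w < n \<and> g (es ! w) = c}" for g :: "'a \<Rightarrow> nat" and c
    unfolding es(2)[symmetric] by (auto simp: n_def set_conv_nth)
  have courteous: "courteous1 M g \<longleftrightarrow> P.proper (\<lambda>i. g (es ! i))" for g :: "'a \<Rightarrow> nat"
  proof -
    have "rank (delete M {e \<in> ground M. g e = c}) = rank M \<longleftrightarrow>
        {w. w < n \<and> g (es ! w) = c} \<in> indep K" for c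
    proof -
      have sub: "{e \<in> ground M. g e = c} \<subseteq> ground M" "{w. w < n \<and> g (es ! w) = c} \<subseteq> {..<n}" by auto
      show ?thesis using M.rank_delete_eq_iff[OF sub(1)] indep_K[OF sub(2)] by (simp only: classes)
    qed
    then have "courteous1 M g \<longleftrightarrow> (\<forall>c. {w. w < n \<and> g (es ! w) = c} \<in> indep K)"
      by (simp only: courteous1_def)
    also have "\<dots> \<longleftrightarrow> P.proper (\<lambda>i. g (es ! i))"
      unfolding P.proper_def
    proof (intro iffI allI)
      \<comment> \<open>\<open>courteous1\<close> also quantifies over colors that do not occur;
        their classes are empty, hence independent.\<close>
      fix c assume *: "\<forall>i<n. {w. w < n \<and> g (es ! w) = g (es ! i)} \<in> indep K"
      show "{w. w < n \<and> g (es ! w) = c} \<in> indep K"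
      proof (cases "\<exists>i<n. g (es ! i) = c")
        case False
        then have "{w. w < n \<and> g (es ! w) = c} = {}" by auto
        then show ?thesis by (simp only: K.indep_empty)
      qed (use * in auto)
    qed auto
    finally show ?thesis .
  qed
  have image: "g ` ground M = (\<lambda>i. g (es ! i)) ` {..<n}" for g :: "'a \<Rightarrow> nat"
    unfolding es(2)[symmetric] by (auto simp: n_def set_conv_nth)
  let ?s = "(matroid_input es)(''N'' := ((matroid_input es) ''N'')(0 := n))"
  have "run (2 * n + 3) (indep_oracle M es) courteous_coloring_program (matroid_input es)
    (\<lambda>s'. P.proper (s' ''f'') \<and>
      (\<forall>g :: nat \<Rightarrow> nat. P.proper g \<longrightarrow> card (s' ''f'' ` {..<n}) \<le> card (g ` {..<n})))"
    unfolding courteous_coloring_program_def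
  proof (rule run_Seq, rule run_Assign)
    have "aval (Var ''n'') (matroid_input es) = n" by (simp add: matroid_input_def input_store_def n_def)
    then show "run (2 * n + 3) (indep_oracle M es) (partition dual_indep_test)
      ((matroid_input es)(''N'' := ((matroid_input es) ''N'')
         (aval (Const 0) (matroid_input es) := aval (Var ''n'') (matroid_input es))))
      (\<lambda>s'. P.proper (s' ''f'') \<and>
        (\<forall>g :: nat \<Rightarrow> nat. P.proper g \<longrightarrow> card (s' ''f'' ` {..<n}) \<le> card (g ` {..<n})))"
      using P.run_partition[of ?s] by (simp add: matroid_input_def input_store_def)
  qed
  then obtain t s where exec: "exec (indep_oracle M es) courteous_coloring_program (matroid_input es) t s"
    "t \<le> cost_bound (2 * n + 3) courteous_coloring_program"
    and s: "P.proper (s ''f'')"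
      "\<And>g :: nat \<Rightarrow> nat. P.proper g \<Longrightarrow> card (s ''f'' ` {..<n}) \<le> card (g ` {..<n})"
    unfolding run_def by blast
  define f where "f e = s ''f'' (THE i. i < n \<and> es ! i = e)" for e
  have f: "f (es ! i) = s ''f'' i" if "i < n" for i
  proof -
    have "(THE j. j < n \<and> es ! j = es ! i) = i"
      using that es(1) by (intro the_equality) (auto simp: n_def nth_eq_iff_index_eq)
    then show ?thesis by (simp add: f_def)
  qed
  have "P.proper (\<lambda>i. f (es ! i))"
    using s(1) unfolding P.proper_def by (simp add: f cong: conj_cong)
  moreover have "(\<lambda>i. f (es ! i)) ` {..<n} = s ''f'' ` {..<n}" using f by auto
  ultimately have "min_courteous1 M f" unfolding min_courteous1_def courteous image using s(2) by simp
  moreover have "output_coloring es s f" using f by (simp add: output_coloring_def n_def)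
  ultimately show ?thesis using exec card by auto
qed

section \<open>Graphs\<close>

text \<open>Edge \<open>j\<close> joins \<open>u j\<close> and \<open>w j\<close>.\<close>

definition conn :: "(nat \<Rightarrow> nat) \<Rightarrow> (nat \<Rightarrow> nat) \<Rightarrow> nat set \<Rightarrow> nat rel" where
  "conn u w F = ((\<lambda>j. (u j, w j)) ` F \<union> (\<lambda>j. (w j, u j)) ` F)\<^sup>*"

definition spanning :: "nat \<Rightarrow> (nat \<Rightarrow> nat) \<Rightarrow> (nat \<Rightarrow> nat) \<Rightarrow> nat set \<Rightarrow> bool" where
  "spanning nv u w F \<longleftrightarrow> (\<forall>a<nv. \<forall>b<nv. (a, b) \<in> conn u w F)"

lemma conn_refl [simp]: "(a, a) \<in> conn u w F"
  by (simp add: conn_def)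

lemma conn_trans: "(a, b) \<in> conn u w F \<Longrightarrow> (b, c) \<in> conn u w F \<Longrightarrow> (a, c) \<in> conn u w F"
  unfolding conn_def by (rule rtrancl_trans)

lemma conn_sym: "(a, b) \<in> conn u w F \<Longrightarrow> (b, a) \<in> conn u w F"
proof -
  have "sym (conn u w F)" unfolding conn_def by (intro sym_rtrancl symI) auto
  then show "(a, b) \<in> conn u w F \<Longrightarrow> (b, a) \<in> conn u w F" by (rule symD)
qed

lemma conn_edge: "j \<in> F \<Longrightarrow> (u j, w j) \<in> conn u w F"
  unfolding conn_def by (intro r_into_rtrancl) auto

lemma conn_mono: "F \<subseteq> F' \<Longrightarrow> conn u w F \<subseteq> conn u w F'"
  unfolding conn_def by (intro rtrancl_mono) auto

lemma conn_empty: "conn u w {} = Id"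
  by (simp add: conn_def)

text \<open>A connection never needs to cross the new edge twice. This closed form drives the
  exchange argument below and is also the update rule for the component labels in
  \<open>connectivity_test\<close>.\<close>

lemma conn_insert:
  "(a, b) \<in> conn u w (insert e F) \<longleftrightarrow> (a, b) \<in> conn u w F \<or>
    (a, u e) \<in> conn u w F \<and> (w e, b) \<in> conn u w F \<or>
    (a, w e) \<in> conn u w F \<and> (u e, b) \<in> conn u w F" (is "?L \<longleftrightarrow> ?R b")
proof
  assume ?L
  then show "?R b" unfolding conn_def[of u w "insert e F"]
  proof (induction rule: rtrancl_induct)
    case (step b c)
    then consider "(b, c) \<in> conn u w F" | "b = u e" "c = w e" | "b = w e" "c = u e"
      using conn_edge conn_sym by fast
    then show ?case
    proof cases
      case 1
      then show ?thesis using step.IH conn_trans by blast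
    next
      case 2
      then show ?thesis using step.IH conn_refl by blast
    next
      case 3
      then show ?thesis using step.IH conn_refl by blast
    qed
  qed simp
next
  have "conn u w F \<subseteq> conn u w (insert e F)" by (rule conn_mono) auto
  moreover have "(u e, w e) \<in> conn u w (insert e F)" by (rule conn_edge) simp
  ultimately show "?R b \<Longrightarrow> ?L" using conn_sym conn_trans by (meson subsetD)
qed

lemma conn_insert_redundant:
  assumes e: "(u e, w e) \<in> conn u w F"
  shows "conn u w (insert e F) = conn u w F"
proof -
  have "(a, b) \<in> conn u w (insert e F) \<longleftrightarrow> (a, b) \<in> conn u w F" for a b
    unfolding conn_insert
    using conn_trans[OF conn_trans[OF _ e]] conn_trans[OF conn_trans[OF _ conn_sym[OF e]]] by blast
  then show ?thesis by auto
qed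

lemma spanning_mono: "spanning nv u w F \<Longrightarrow> F \<subseteq> F' \<Longrightarrow> spanning nv u w F'"
  unfolding spanning_def using conn_mono by blast

text \<open>The hypothesis on \<open>q\<close> says that \<open>X\<close> has at most two components.\<close>

lemma conn_of_not_spanning:
  assumes q: "spanning nv u w (insert q X)" "u q < nv"
    and p: "\<not> spanning nv u w (insert p X)" "u p < nv" "w p < nv"
  shows "(u p, w p) \<in> conn u w X"
proof (rule ccontr)
  assume no: "(u p, w p) \<notin> conn u w X"
  have split: "(a, u q) \<in> conn u w X \<or> (a, w q) \<in> conn u w X" if "a < nv" for a
    using q that conn_insert[of a "u q" u w q X] unfolding spanning_def by blast
  have "(u q, w q) \<in> conn u w (insert p X)"
    using split[OF p(2)] split[OF p(3)] no conn_sym conn_trans unfolding conn_insert by meson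
  moreover have "(a, u q) \<in> conn u w (insert p X) \<or> (a, w q) \<in> conn u w (insert p X)" if "a < nv" for a
    using split[OF that] unfolding conn_insert by blast
  ultimately have "(a, u q) \<in> conn u w (insert p X)" if "a < nv" for a
    using that conn_sym conn_trans by meson
  then have "spanning nv u w (insert p X)" unfolding spanning_def using conn_sym conn_trans by meson
  then show False using p(1) by blast
qed

text \<open>Induction on \<open>Q\<close>: an edge \<open>q\<close> moves into the common part, and
  the induction hypothesis, applied twice, removes \<open>p\<close> and \<open>p'\<close> from
  \<open>P\<close> at the price of \<open>q\<close>. What is left without \<open>q\<close> has at
  most two components, and one of \<open>p\<close> and \<open>p'\<close> can take the place of
  \<open>q\<close> in joining them.\<close>

lemma spanning_exchange:
  assumes "finite Q" "\<And>j. j \<in> P \<union> Q \<Longrightarrow> u j < nv \<and> w j < nv"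
    and "spanning nv u w (D \<union> Q)" "spanning nv u w (D \<union> P)" "card Q < card P"
  shows "\<exists>p\<in>P. spanning nv u w (D \<union> (P - {p}))"
  using assms
proof (induction Q arbitrary: D P rule: finite_induct)
  case empty
  then obtain p where "p \<in> P" by fastforce
  then show ?case using empty spanning_mono[of nv u w D] by auto
next
  case (insert q Q)
  let ?D = "insert q D"
  have Q: "spanning nv u w (?D \<union> Q)" using insert.prems(2) by simp
  have P: "spanning nv u w (?D \<union> P)" by (rule spanning_mono[OF insert.prems(3)]) auto
  have "card Q < card P" using insert.prems(4) insert.hyps by simp
  then obtain p where p: "p \<in> P" "spanning nv u w (?D \<union> (P - {p}))"
    using insert.IH[of P ?D] insert.prems(1) Q P by auto
  have "finite P" using insert.prems(4) card.infinite by fastforce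
  then have "card Q < card (P - {p})" using insert.prems(4) insert.hyps p(1) by simp
  then obtain p' where p': "p' \<in> P - {p}" "spanning nv u w (?D \<union> (P - {p} - {p'}))"
    using insert.IH[of "P - {p}" ?D] insert.prems(1) Q p(2) by auto
  let ?X = "D \<union> (P - {p} - {p'})"
  have q: "spanning nv u w (insert q ?X)" "u q < nv" using p'(2) insert.prems(1) by auto
  have X1: "insert p ?X = D \<union> (P - {p'})" and X2: "insert p' ?X = D \<union> (P - {p})"
    and X3: "insert p (insert p' ?X) = D \<union> P" using p(1) p'(1) by auto
  show ?case
  proof (rule ccontr)
    assume no: "\<not> ?thesis"
    have ends: "u p < nv" "w p < nv" "u p' < nv" "w p' < nv" using insert.prems(1) p(1) p'(1) by auto
    have no': "\<not> spanning nv u w (D \<union> (P - {x}))" if "x \<in> P" for x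
      using no bexI[OF _ that, of "\<lambda>x. spanning nv u w (D \<union> (P - {x}))"] by argo
    have n1: "\<not> spanning nv u w (insert p ?X)" unfolding X1 using no'[of p'] p'(1) by simp
    have n2: "\<not> spanning nv u w (insert p' ?X)" unfolding X2 using no'[OF p(1)] .
    \<comment> \<open>Adding \<open>p\<close> does not span although adding \<open>q\<close> does,
      so \<open>p\<close> has both ends in one component of \<open>?X\<close> and is redundant in
      \<open>D \<union> P\<close>.\<close>
    have "(u p, w p) \<in> conn u w ?X" by (rule conn_of_not_spanning[OF q n1 ends(1,2)])
    then have "(u p, w p) \<in> conn u w (insert p' ?X)" unfolding conn_insert by blast
    from conn_insert_redundant[OF this] have "spanning nv u w (insert p' ?X)"
      using insert.prems(3) by (simp add: spanning_def X3)
    then show False using n2 by blast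
  qed
qed

section \<open>The cographic matroid\<close>

definition cographic :: "nat \<Rightarrow> nat \<Rightarrow> (nat \<Rightarrow> nat) \<Rightarrow> (nat \<Rightarrow> nat) \<Rightarrow> nat set_system" where
  "cographic nv m u w = \<lparr>ground = {..<m}, indep = {Y. Y \<subseteq> {..<m} \<and> spanning nv u w ({..<m} - Y)}\<rparr>"

text \<open>The complements of \<open>X\<close> and \<open>Y\<close> share the edges outside both
  sets; beyond these they consist of \<open>Y - X\<close> and \<open>X - Y\<close>. Augmentation is
  thus \<open>spanning_exchange\<close> with \<open>P = Y - X\<close> and \<open>Q = X - Y\<close>:
  an edge that the complement of \<open>X\<close> can spare joins \<open>X\<close>.\<close>

lemma matroid_cographic:
  assumes "\<And>j. j < m \<Longrightarrow> u j < nv \<and> w j < nv" "spanning nv u w {..<m}"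
  shows "matroid (cographic nv m u w)"
proof
  fix X Y assume X: "X \<in> indep (cographic nv m u w)" and Y: "Y \<in> indep (cographic nv m u w)"
    and less: "card X < card Y"
  have sub: "X \<subseteq> {..<m}" "Y \<subseteq> {..<m}" using X Y by (auto simp: cographic_def)
  then have fin: "finite X" "finite Y" using finite_subset by blast+
  let ?D = "{..<m} - X - Y"
  have "?D \<union> (X - Y) = {..<m} - Y" "?D \<union> (Y - X) = {..<m} - X" using sub by auto
  then have "spanning nv u w (?D \<union> (X - Y))" "spanning nv u w (?D \<union> (Y - X))"
    using X Y by (auto simp: cographic_def)
  moreover have "card (X - Y) < card (Y - X)" using less fin by (simp add: card_less_sym_Diff)
  ultimately obtain y where y: "y \<in> Y - X" "spanning nv u w (?D \<union> (Y - X - {y}))"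
    using spanning_exchange[of "X - Y" "Y - X" u nv w ?D] fin sub assms(1) by auto
  moreover have "?D \<union> (Y - X - {y}) = {..<m} - insert y X" using sub y(1) by auto
  ultimately show "\<exists>y\<in>Y - X. insert y X \<in> indep (cographic nv m u w)"
    using sub by (auto simp: cographic_def)
next
  fix X Y assume "Y \<in> indep (cographic nv m u w)" "X \<subseteq> Y"
  then show "X \<in> indep (cographic nv m u w)"
    using spanning_mono[of nv u w "{..<m} - Y" "{..<m} - X"] by (auto simp: cographic_def)
qed (use assms in \<open>auto simp: cographic_def\<close>)

section \<open>Paths in the multigraph and connections between positions\<close>

lemma path_suffix: "path G x p v \<Longrightarrow> a \<in> insert x (snd ` set p) \<Longrightarrow> \<exists>q. path G a q v"
proof (induction p arbitrary: x)
  case (Cons st p)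
  obtain e y where st: "st = (e, y)" by force
  have "path G y p v" using Cons.prems(1) st by (auto simp: path_def)
  then show ?case using Cons st by (cases "a = x") auto
qed auto

text \<open>\<open>conn\<close> yields walks, whereas \<open>connected_graph\<close> asks for
  distinct vertices. If the new first vertex already lies on the path, the suffix starting there is
  taken.\<close>

lemma path_of_walk: "walk G x p v \<Longrightarrow> \<exists>q. path G x q v"
proof (induction p arbitrary: x)
  case Nil
  then show ?case by (intro exI[of _ "[]"]) (auto simp: path_def)
next
  case (Cons st p)
  obtain e y where st: "st = (e, y)" by force
  obtain q where q: "path G y q v" using Cons st by auto
  show ?case
  proof (cases "x \<in> insert y (snd ` set q)")
    case True
    then show ?thesis using path_suffix[OF q] by blast
  next
    case False
    then have "path G x ((e, y) # q) v" using Cons.prems q st by (auto simp: path_def)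
    then show ?thesis by blast
  qed
qed

lemma walk_edges_update:
  "walk G x p v \<Longrightarrow> path_edges p \<inter> F = {} \<Longrightarrow> walk (G\<lparr>edges := edges G - F\<rparr>) x p v"
  by (induction p arbitrary: x) (auto simp: path_edges_def)

locale indexed_graph =
  fixes G :: "('v, 'e) multigraph" and vs :: "'v list" and es :: "'e list" and u w :: "nat \<Rightarrow> nat"
  assumes vs: "enumerates vs (verts G)" and es: "enumerates es (edges G)"
    and ends: "j < length es \<Longrightarrow> u j < length vs \<and> w j < length vs \<and>
      ends G (es ! j) = Upair (vs ! u j) (vs ! w j)"
begin

lemma vs_inj: "a < length vs \<Longrightarrow> b < length vs \<Longrightarrow> vs ! a = vs ! b \<longleftrightarrow> a = b"
  using vs by (simp add: enumerates_def nth_eq_iff_index_eq)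

lemma verts_nth: "x \<in> verts G \<longleftrightarrow> (\<exists>a<length vs. x = vs ! a)"
  using vs by (auto simp: enumerates_def set_conv_nth)

lemma walk_conn:
  assumes "F \<subseteq> {..<length es}" "walk (G\<lparr>edges := (!) es ` F\<rparr>) (vs ! a) p (vs ! b)"
    "a < length vs" "b < length vs"
  shows "(a, b) \<in> conn u w F"
  using assms(2,3)
proof (induction p arbitrary: a)
  case Nil
  then show ?case using vs_inj assms(4) by simp
next
  case (Cons st p)
  obtain e y where st: "st = (e, y)" by force
  obtain j where j: "j \<in> F" "e = es ! j" using Cons.prems(1) st by auto
  have jm: "j < length es" using j(1) assms(1) by auto
  have up: "Upair (vs ! u j) (vs ! w j) = Upair (vs ! a) y"
    using Cons.prems(1) st j ends[OF jm] by simp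
  then consider "a = u j" "y = vs ! w j" | "a = w j" "y = vs ! u j"
    using vs_inj ends[OF jm] Cons.prems(2) by auto
  then obtain c where c: "y = vs ! c" "c < length vs" "(a, c) \<in> conn u w F"
    using conn_edge[OF j(1), of u w] conn_sym ends[OF jm] by metis
  have "walk (G\<lparr>edges := (!) es ` F\<rparr>) (vs ! c) p (vs ! b)" using Cons.prems(1) st c(1) by simp
  then show ?case using Cons.IH c conn_trans by blast
qed

lemma conn_walk:
  assumes "F \<subseteq> {..<length es}" "(a, b) \<in> conn u w F" "b < length vs"
  shows "a < length vs \<and> (\<exists>p. walk (G\<lparr>edges := (!) es ` F\<rparr>) (vs ! a) p (vs ! b))"
  using assms(2)[unfolded conn_def]
proof (induction rule: converse_rtrancl_induct)
  case base
  have "walk (G\<lparr>edges := (!) es ` F\<rparr>) (vs ! b) [] (vs ! b)" using assms(3) verts_nth by auto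
  then show ?case using assms(3) by blast
next
  case (step a c)
  then obtain p where p: "walk (G\<lparr>edges := (!) es ` F\<rparr>) (vs ! c) p (vs ! b)" by blast
  obtain j where j: "j \<in> F" "(a, c) = (u j, w j) \<or> (a, c) = (w j, u j)" using step.hyps(1) by auto
  have jm: "j < length es" using j(1) assms(1) by auto
  have "Upair (vs ! u j) (vs ! w j) = Upair (vs ! a) (vs ! c)" "a < length vs"
    using j(2) ends[OF jm] by auto
  then have "walk (G\<lparr>edges := (!) es ` F\<rparr>) (vs ! a) ((es ! j, vs ! c) # p) (vs ! b)"
    using p j(1) ends[OF jm] verts_nth by auto
  then show ?case using \<open>a < length vs\<close> by blast
qed

lemma connected_iff_spanning:
  assumes "F \<subseteq> {..<length es}" "verts G \<noteq> {}"
  shows "connected_graph (G\<lparr>edges := (!) es ` F\<rparr>) \<longleftrightarrow> spanning (length vs) u w F"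
proof
  assume c: "connected_graph (G\<lparr>edges := (!) es ` F\<rparr>)"
  show "spanning (length vs) u w F"
    unfolding spanning_def
  proof (intro allI impI)
    fix a b assume ab: "a < length vs" "b < length vs"
    then have "vs ! a \<in> verts G" "vs ! b \<in> verts G" using verts_nth by auto
    then obtain p where "path (G\<lparr>edges := (!) es ` F\<rparr>) (vs ! a) p (vs ! b)"
      using c by (auto simp: connected_graph_def)
    then have "walk (G\<lparr>edges := (!) es ` F\<rparr>) (vs ! a) p (vs ! b)" by (simp add: path_def)
    from walk_conn[OF assms(1) this ab] show "(a, b) \<in> conn u w F" .
  qed
next
  assume s: "spanning (length vs) u w F"
  have "\<exists>p. path (G\<lparr>edges := (!) es ` F\<rparr>) x p y" if xy: "x \<in> verts G" "y \<in> verts G" for x y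
  proof -
    obtain a b where ab: "a < length vs" "x = vs ! a" "b < length vs" "y = vs ! b"
      using xy verts_nth by auto
    then have "(a, b) \<in> conn u w F" using s by (simp add: spanning_def)
    from conn_walk[OF assms(1) this ab(3)] show ?thesis using ab path_of_walk by fast
  qed
  then show "connected_graph (G\<lparr>edges := (!) es ` F\<rparr>)" using assms(2) by (simp add: connected_graph_def)
qed

lemma edges_diff:
  assumes "X \<subseteq> {..<length es}"
  shows "edges G - (!) es ` X = (!) es ` ({..<length es} - X)"
proof -
  have "inj_on ((!) es) {..<length es}" using es by (auto simp: enumerates_def intro: inj_on_nth)
  moreover have "edges G = (!) es ` {..<length es}" using es by (auto simp: enumerates_def set_conv_nth)
  ultimately show ?thesis using assms by (simp add: inj_on_image_set_diff)
qed

text \<open>An edge lies on at most one of two edge-disjoint paths. As \<open>X\<close> is empty or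
  \<open>{j}\<close>, one argument yields connectedness and the absence of bridges; with a single
  vertex only \<open>a = b\<close> occurs.\<close>

lemma spanning_minus_edge:
  assumes "two_edge_connected G" "X \<subseteq> {..<length es}" "X \<subseteq> {j}"
  shows "spanning (length vs) u w ({..<length es} - X)"
  unfolding spanning_def
proof (intro allI impI)
  fix a b assume ab: "a < length vs" "b < length vs"
  have card: "card (verts G) = length vs" using vs distinct_card[of vs] by (auto simp: enumerates_def)
  show "(a, b) \<in> conn u w ({..<length es} - X)"
  proof (cases "a = b")
    case False
    then have "length vs \<noteq> 1" using ab by auto
    then have two: "\<forall>x\<in>verts G. \<forall>y\<in>verts G. x \<noteq> y \<longrightarrow>
        (\<exists>p q. path G x p y \<and> path G x q y \<and> path_edges p \<inter> path_edges q = {})"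
      using assms(1) card unfolding two_edge_connected_def by simp
    have "vs ! a \<in> verts G" "vs ! b \<in> verts G" "vs ! a \<noteq> vs ! b"
      using ab verts_nth vs_inj False by auto
    with two obtain p q where pq: "path G (vs ! a) p (vs ! b)" "path G (vs ! a) q (vs ! b)"
      "path_edges p \<inter> path_edges q = {}"
      by blast
    then have "es ! j \<notin> path_edges p \<or> es ! j \<notin> path_edges q" by blast
    then obtain p' where p': "path G (vs ! a) p' (vs ! b)" "path_edges p' \<inter> (!) es ` X = {}"
      using pq assms(3) by blast
    then have "walk (G\<lparr>edges := edges G - (!) es ` X\<rparr>) (vs ! a) p' (vs ! b)"
      using walk_edges_update[of G "vs ! a" p' "vs ! b" "(!) es ` X"] by (simp add: path_def)
    then have "walk (G\<lparr>edges := (!) es ` ({..<length es} - X)\<rparr>) (vs ! a) p' (vs ! b)"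
      using edges_diff[OF assms(2)] by simp
    from walk_conn[OF _ this ab] show ?thesis by blast
  qed simp
qed

end

text \<open>\<open>tb\<close> holds a component label for each vertex, initially its own position,
  and every edge outside \<open>y\<close> merges the labels of its ends. \<open>r\<close> first
  holds the label to be replaced and receives the answer only afterwards.\<close>

definition connectivity_test :: com where
  "connectivity_test =
     Seq (For ''ta'' (Var ''n'') (Assign ''tb'' (Var ''ta'') (Var ''ta'')))
    (Seq (For ''tc'' (Var ''N'')
       (If (Equal (Cell ''y'' (Var ''tc'')) (Const 0))
         (Seq (Assign ''r'' (Const 0) (Cell ''tb'' (Cell ''u'' (Var ''tc''))))
         (Seq (Assign ''td'' (Const 0) (Cell ''tb'' (Cell ''w'' (Var ''tc''))))
              (For ''ta'' (Var ''n'')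
                (If (Equal (Cell ''tb'' (Var ''ta'')) (Var ''r''))
                  (Assign ''tb'' (Var ''ta'') (Var ''td'')) Skip))))
         Skip))
    (Seq (Assign ''r'' (Const 0) (Const 1))
         (For ''ta'' (Var ''n'')
           (If (Equal (Cell ''tb'' (Var ''ta'')) (Cell ''tb'' (Const 0))) Skip
             (Assign ''r'' (Const 0) (Const 0))))))"

lemma run_connectivity_test:
  assumes N: "nv \<le> N" "m \<le> N" and s: "s ''n'' 0 = nv" "s ''N'' 0 = m"
    and uw: "\<And>j. j < m \<Longrightarrow> s ''u'' j < nv \<and> s ''w'' j < nv"
  shows "run N orc connectivity_test s
    (\<lambda>s'. s' ''r'' 0 = (if spanning nv (s ''u'') (s ''w'') {j. j < m \<and> s ''y'' j = 0} then 1 else 0))"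
proof -
  define u w where "u = s ''u''" and "w = s ''w''"
  define F where "F i = {j. j < i \<and> s ''y'' j = 0}" for i
  let ?lab = "\<lambda>i s'. \<forall>a<nv. \<forall>b<nv. s' ''tb'' a = s' ''tb'' b \<longleftrightarrow> (a, b) \<in> conn u w (F i)"
  show ?thesis unfolding connectivity_test_def
  proof (rule run_Seq, rule run_For[where K = nv and P = "\<lambda>i s'. \<forall>a<i. s' ''tb'' a = a"], goal_cases)
    case (5 i s')
    then show ?case by (intro run_Assign) (auto simp: less_Suc_eq)
  next
    case (6 s1)
    have s1: "s1 ''n'' 0 = nv" "s1 ''N'' 0 = m" "s1 ''u'' = u" "s1 ''w'' = w" "s1 ''y'' = s ''y''"
      using s by (simp_all add: 6(2) u_def w_def)
    show ?case
    proof (rule run_Seq, rule run_For[where K = m and P = ?lab], goal_cases)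
      case 4
      show ?case using 6(1) by (simp add: F_def conn_empty)
    next
      case (5 i s')
      have s': "s' ''n'' 0 = nv" "s' ''u'' = u" "s' ''w'' = w" "s' ''y'' = s ''y''"
        using s1 by (simp_all add: 5(4))
      have ui: "u i < nv" "w i < nv" using uw 5(1) by (auto simp: u_def w_def)
      show ?case
      proof (cases "s ''y'' i = 0")
        case False
        then have "F (Suc i) = F i" by (auto simp: F_def less_Suc_eq)
        then show ?thesis using 5(2,3) s' False by (intro run_intros) simp_all
      next
        case True
        then have F: "F (Suc i) = insert i (F i)" by (auto simp: F_def less_Suc_eq)
        \<comment> \<open>Both labels are copied before the inner loop, which may overwrite the
          label of \<open>u i\<close> itself.\<close>
        define A B where "A = s' ''tb'' (u i)" and "B = s' ''tb'' (w i)"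
        let ?s = "s'(''r'' := (s' ''r'')(0 := A), ''td'' := (s' ''td'')(0 := B))"
        let ?tb = "\<lambda>a. if s' ''tb'' a = A then B else s' ''tb'' a"
        have "run N orc (For ''ta'' (Var ''n'') (If (Equal (Cell ''tb'' (Var ''ta'')) (Var ''r''))
            (Assign ''tb'' (Var ''ta'') (Var ''td'')) Skip)) ?s
          (\<lambda>s''. ?lab (Suc i) (s''(''tc'' := (s'' ''tc'')(0 := Suc i))))"
        proof (rule run_For[where K = nv and
              P = "\<lambda>j s''. \<forall>a<nv. s'' ''tb'' a = (if a < j then ?tb a else s' ''tb'' a)"], goal_cases)
          case (5 j s'')
          have "s'' ''r'' 0 = A" "s'' ''td'' 0 = B" by (simp_all add: 5(4))
          then show ?case using 5(1-3) by (intro run_intros) (auto simp: less_Suc_eq)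
        next
          case (6 s'')
          have "?tb a = ?tb b \<longleftrightarrow> (a, b) \<in> conn u w (insert i (F i))" if ab: "a < nv" "b < nv" for a b
          proof -
            have "(a, b) \<in> conn u w (F i) \<longleftrightarrow> s' ''tb'' a = s' ''tb'' b"
              "(a, u i) \<in> conn u w (F i) \<longleftrightarrow> s' ''tb'' a = A"
              "(w i, b) \<in> conn u w (F i) \<longleftrightarrow> B = s' ''tb'' b"
              "(a, w i) \<in> conn u w (F i) \<longleftrightarrow> s' ''tb'' a = B"
              "(u i, b) \<in> conn u w (F i) \<longleftrightarrow> A = s' ''tb'' b"
              using \<open>?lab i s'\<close> ab ui by (simp_all add: A_def B_def)
            then show ?thesis unfolding conn_insert by auto
          qed
          then show ?case using 6(1) by (simp add: F)
        qed (use s' N in auto)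
        then show ?thesis using 5(2) s' True
          by (intro run_Seq run_If run_Assign) (simp_all add: A_def B_def)
      qed
    next
      case (6 s2)
      have s2: "s2 ''n'' 0 = nv" using s1 by (simp add: 6(2))
      show ?case
      proof (rule run_Seq, rule run_Assign, rule run_For[where K = nv and
            P = "\<lambda>i s'. s' ''r'' 0 = (if \<forall>a<i. s2 ''tb'' a = s2 ''tb'' 0 then 1 else 0)"], goal_cases)
        case (5 i s')
        have "s' ''tb'' = s2 ''tb''" by (simp add: 5(4))
        then show ?case using 5(2,3) by (intro run_intros) (auto simp: less_Suc_eq)
      next
        case (6 s')
        \<comment> \<open>Comparison with vertex 0 is enough; for \<open>nv = 0\<close> both sides
          hold vacuously.\<close>
        have "(\<forall>a<nv. s2 ''tb'' a = s2 ''tb'' 0) \<longleftrightarrow> (\<forall>a<nv. \<forall>b<nv. s2 ''tb'' a = s2 ''tb'' b)"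
          by (metis gr_zeroI not_less_zero)
        also have "\<dots> \<longleftrightarrow> spanning nv u w (F m)"
          using \<open>?lab m s2\<close> by (simp add: spanning_def)
        finally show ?case using 6(1) by (simp add: u_def w_def F_def)
      qed (use s2 N in auto)
    qed (use s1 N in auto)
  qed (use s N in auto)
qed

section \<open>Minimum edge-1-color-avoiding connected colorings\<close>

definition avoiding_coloring_program :: com where
  "avoiding_coloring_program = Seq (Assign ''N'' (Const 0) (Var ''m'')) (partition connectivity_test)"

lemma oracle_free_avoiding_coloring_program: "oracle_free avoiding_coloring_program"
  by (simp add: avoiding_coloring_program_def program_defs connectivity_test_def)

lemma avoiding_coloring_program_correct:
  fixes G :: "('v, 'e) multigraph"
  assumes "two_edge_connected G" "graph_input G vs es s0"
  shows "\<exists>t s f. exec orc avoiding_coloring_program s0 t s \<and>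
    t \<le> cost_bound (2 * (card (verts G) + card (edges G)) + 3) avoiding_coloring_program \<and>
    output_coloring es s f \<and> min_edge1_color_avoiding_connected G f"
proof -
  obtain us ws where uws: "length us = length es" "length ws = length es"
    "\<And>j. j < length es \<Longrightarrow> us ! j < length vs \<and> ws ! j < length vs \<and>
        ends G (es ! j) = Upair (vs ! (us ! j)) (vs ! (ws ! j))"
    and s0: "s0 = input_store [(''n'', [length vs]), (''m'', [length es]), (''u'', us), (''w'', ws)]"
    using assms(2) by (auto simp: graph_input_def)
  define m nv where "m = length es" and "nv = length vs"
  define u w where "u = s0 ''u''" and "w = s0 ''w''"
  have u: "u j = us ! j" "w j = ws ! j" if "j < m" for j
    using that uws by (auto simp: u_def w_def s0 input_store_def m_def)
  have in0: "s0 ''n'' 0 = nv" "s0 ''m'' 0 = m" "s0 ''k'' 0 = 0" "s0 ''f'' i = 0" for i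
    by (auto simp: s0 input_store_def m_def nv_def)
  interpret I: indexed_graph G vs es u w
    by unfold_locales (use assms(2) uws u in \<open>auto simp: graph_input_def m_def\<close>)
  have cards: "card (verts G) = nv" "card (edges G) = m"
    using I.vs I.es distinct_card[of vs] distinct_card[of es] by (auto simp: enumerates_def nv_def m_def)
  have vne: "verts G \<noteq> {}" using assms(1) by (auto simp: two_edge_connected_def)
  have ends: "u j < nv \<and> w j < nv" if "j < m" for j using I.ends that by (auto simp: m_def nv_def)
  have bridge: "spanning nv u w ({..<m} - {j})" if "j < m" for j
    using I.spanning_minus_edge[OF assms(1), of "{j}"] that by (simp add: m_def nv_def)
  have span: "spanning nv u w {..<m}"
    using I.spanning_minus_edge[OF assms(1), of "{}"] by (simp add: m_def nv_def)
  define K where "K = cographic nv m u w"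
  \<comment> \<open>The connectivity test loops over vertices as well as edges, so \<open>N\<close>
    must cover \<open>nv\<close> in addition to \<open>2 * m + 3\<close>.\<close>
  define N where "N = 2 * (nv + m) + 3"
  interpret K: matroid K unfolding K_def by (rule matroid_cographic) (use ends span in auto)
  interpret P: partition_program K m N orc connectivity_test
    "\<lambda>s. s ''N'' 0 = m \<and> s ''n'' 0 = nv \<and> s ''u'' = u \<and> s ''w'' = w"
  proof
    fix i assume "i < m"
    then show "{i} \<in> indep K" using bridge by (simp add: K_def cographic_def)
  next
    fix s :: store assume s: "s ''N'' 0 = m \<and> s ''n'' 0 = nv \<and> s ''u'' = u \<and> s ''w'' = w"
    \<comment> \<open>\<open>y\<close> marks the edges to be deleted, while the test examines the
      graph formed by the unmarked ones.\<close>
    have "{j. j < m \<and> s ''y'' j = 0} = {..<m} - {i. i < m \<and> s ''y'' i \<noteq> 0}" by auto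
    then have "spanning nv u w {j. j < m \<and> s ''y'' j = 0} \<longleftrightarrow> {i. i < m \<and> s ''y'' i \<noteq> 0} \<in> indep K"
      by (auto simp: K_def cographic_def)
    then show "run N orc connectivity_test s
      (\<lambda>s'. s' ''r'' 0 = (if {i. i < m \<and> s ''y'' i \<noteq> 0} \<in> indep K then 1 else 0))"
      using run_connectivity_test[of nv N m s orc] s ends by (simp add: N_def)
  qed (auto simp: K_def cographic_def N_def connectivity_test_def scratch_names_def input_names_def)
  have classes: "{e \<in> edges G. g e = c} = (!) es ` {j. j < m \<and> g (es ! j) = c}" for g :: "'e \<Rightarrow> nat" and c
    using I.es by (auto simp: enumerates_def m_def set_conv_nth)
  have image: "g ` edges G = (\<lambda>j. g (es ! j)) ` {..<m}" for g :: "'e \<Rightarrow> nat"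
  proof -
    have "edges G = (!) es ` {..<m}" using I.es by (auto simp: enumerates_def m_def set_conv_nth)
    then show ?thesis by (simp add: image_image)
  qed
  have connected: "connected_graph (delete_edges G {e \<in> edges G. g e = c}) \<longleftrightarrow>
      {j. j < m \<and> g (es ! j) = c} \<in> indep K" for g :: "'e \<Rightarrow> nat" and c
  proof -
    have sub: "{j. j < m \<and> g (es ! j) = c} \<subseteq> {..<length es}" by (auto simp: m_def)
    show ?thesis
      unfolding delete_edges_def classes I.edges_diff[OF sub]
      using I.connected_iff_spanning[of "{..<length es} - {j. j < m \<and> g (es ! j) = c}"] vne sub
      by (simp add: K_def cographic_def m_def nv_def)
  qed
  \<comment> \<open>The palette \<open>C\<close> may exceed the colors that occur;
    \<open>P.proper\<close> concerns only the latter, all of which lie in \<open>C\<close>.\<close>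
  have avoiding: "P.proper (\<lambda>j. g (es ! j))" if "edge1_color_avoiding_connected G C g"
    for g :: "'e \<Rightarrow> nat" and C
  proof -
    have "{j. j < m \<and> g (es ! j) = g (es ! i)} \<in> indep K" if i: "i < m" for i
    proof -
      have "g (es ! i) \<in> C"
        using \<open>edge1_color_avoiding_connected G C g\<close> i
        unfolding edge1_color_avoiding_connected_def image by blast
      then show ?thesis
        using \<open>edge1_color_avoiding_connected G C g\<close>
        unfolding edge1_color_avoiding_connected_def connected by blast
    qed
    then show ?thesis by (simp add: P.proper_def)
  qed
  let ?s = "s0(''N'' := (s0 ''N'')(0 := m))"
  have "run N orc avoiding_coloring_program s0 (\<lambda>s'. P.proper (s' ''f'') \<and>
      (\<forall>g :: nat \<Rightarrow> nat. P.proper g \<longrightarrow> card (s' ''f'' ` {..<m}) \<le> card (g ` {..<m})))"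
    unfolding avoiding_coloring_program_def
    by (rule run_Seq, rule run_Assign) (use P.run_partition[of ?s] in0 in \<open>simp add: u_def w_def\<close>)
  then obtain t s where exec: "exec orc avoiding_coloring_program s0 t s"
    "t \<le> cost_bound N avoiding_coloring_program"
    and s: "P.proper (s ''f'')"
      "\<And>g :: nat \<Rightarrow> nat. P.proper g \<Longrightarrow> card (s ''f'' ` {..<m}) \<le> card (g ` {..<m})"
    unfolding run_def by blast
  define f where "f e = s ''f'' (THE i. i < m \<and> es ! i = e)" for e
  have f: "f (es ! i) = s ''f'' i" if "i < m" for i
  proof -
    have "(THE j. j < m \<and> es ! j = es ! i) = i"
      using that I.es by (intro the_equality) (auto simp: m_def enumerates_def nth_eq_iff_index_eq)
    then show ?thesis by (simp add: f_def)
  qed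
  have pf: "{j. j < m \<and> f (es ! j) = f (es ! i)} \<in> indep K" if "i < m" for i
  proof -
    have "{j. j < m \<and> f (es ! j) = f (es ! i)} = {j. j < m \<and> s ''f'' j = s ''f'' i}"
      using f that by auto
    then show ?thesis using s(1) that by (simp add: P.proper_def)
  qed
  have fin: "finite (f ` edges G)" unfolding image by simp
  have "edge1_color_avoiding_connected G (f ` edges G) f"
    unfolding edge1_color_avoiding_connected_def connected using fin pf by (auto simp: image)
  moreover have "card (f ` edges G) \<le> card (g ` edges G)"
    if "edge1_color_avoiding_connected G C g" for C and g :: "'e \<Rightarrow> nat"
  proof -
    have "(\<lambda>i. f (es ! i)) ` {..<m} = s ''f'' ` {..<m}" using f by auto
    then show ?thesis using s(2)[OF avoiding[OF that]] by (simp add: image)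
  qed
  ultimately have "min_edge1_color_avoiding_connected G f"
    unfolding min_edge1_color_avoiding_connected_def by blast
  moreover have "output_coloring es s f" using f by (simp add: output_coloring_def m_def)
  ultimately show ?thesis using exec by (auto simp: cards N_def)
qed

section \<open>Polynomial bounds in the input size\<close>

lemma cost_bound_linear_poly:
  "\<exists>p :: nat poly. \<forall>n. cost_bound (2 * n + 3) c = poly p n"
proof -
  obtain p :: "nat poly" where "\<forall>N. cost_bound N c = poly p N" using cost_bound_poly by blast
  then have "cost_bound (2 * n + 3) c = poly (pcompose p [:3, 2:]) n" for n
    by (simp add: poly_pcompose add.commute mult.commute)
  then show ?thesis by blast
qed

theorem theorem3p6:
  shows
    "(\<exists>(alg :: com) (p :: nat poly).
        \<forall>(M :: 'a set_system) es.
          matroid M \<and> bridgeless M \<and> enumerates es (ground M) \<longrightarrow>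
          (\<exists>t s f. exec (indep_oracle M es) alg (matroid_input es) t s \<and>
             t \<le> poly p (card (ground M)) \<and>
             output_coloring es s f \<and> min_courteous1 M f)) \<and>
     (\<exists>(alg :: com) (p :: nat poly). oracle_free alg \<and>
        (\<forall>orc (G :: ('v, 'e) multigraph) vs es s0.
          finite_multigraph G \<and> two_edge_connected G \<and> graph_input G vs es s0 \<longrightarrow>
          (\<exists>t s f. exec orc alg s0 t s \<and>
             t \<le> poly p (card (verts G) + card (edges G)) \<and>
             output_coloring es s f \<and> min_edge1_color_avoiding_connected G f)))"
proof (intro conjI)
  obtain p where p: "\<And>n. cost_bound (2 * n + 3) courteous_coloring_program = poly p n"
    using cost_bound_linear_poly by metis
  show "\<exists>(alg :: com) (p :: nat poly).
        \<forall>(M :: 'a set_system) es.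
          matroid M \<and> bridgeless M \<and> enumerates es (ground M) \<longrightarrow>
          (\<exists>t s f. exec (indep_oracle M es) alg (matroid_input es) t s \<and>
             t \<le> poly p (card (ground M)) \<and>
             output_coloring es s f \<and> min_courteous1 M f)"
    by (rule exI[of _ courteous_coloring_program], rule exI[of _ p])
      (use courteous_coloring_program_correct[where ?'a = 'a, unfolded p] in blast)
  obtain q where q: "\<And>n. cost_bound (2 * n + 3) avoiding_coloring_program = poly q n"
    using cost_bound_linear_poly by metis
  show "\<exists>(alg :: com) (p :: nat poly). oracle_free alg \<and>
        (\<forall>orc (G :: ('v, 'e) multigraph) vs es s0.
          finite_multigraph G \<and> two_edge_connected G \<and> graph_input G vs es s0 \<longrightarrow>
          (\<exists>t s f. exec orc alg s0 t s \<and>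
             t \<le> poly p (card (verts G) + card (edges G)) \<and>
             output_coloring es s f \<and> min_edge1_color_avoiding_connected G f))"
    by (rule exI[of _ avoiding_coloring_program], rule exI[of _ q])
      (use oracle_free_avoiding_coloring_program
         avoiding_coloring_program_correct[where ?'v = 'v and ?'e = 'e, unfolded q] in blast)
qed

end
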